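(* Let $d\ge1$, $\alpha\in(d/(d+2),1)$, and let $\mathbf{X}_1,\dots,\mathbf{X}_n$, $\mathbf{X}_r=[X_{1r},\dots,X_{dr}]^\top$, be an i.i.d. sample. The Basu et al. and the Jones et al. estimators (both of order $\alpha$) of the mean parameter $\boldsymbol{\mu}$ and covariance parameter $\boldsymbol{K}=(k_{ij})=\frac{\nu}{\nu-2}\boldsymbol{\Sigma}$ of the $d$-dimensional Student distribution with index $\alpha$ are the same and are given, for $i,j\in\{1,\dots,d\}$, $i\le j$, by $$\widehat{\boldsymbol{\mu}}=\overline{\mathbf{X}}=\frac1n\sum_{r=1}^n\mathbf{X}_r,\qquad \widehat{k_{ij}}=\frac1n\sum_{r=1}^nX_{ir}X_{jr}-\widehat{\mu_i}\,\widehat{\mu_j}.$$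
   Context: Student distributions with index $\alpha\in(d/(d+2),1)$: $\nu>2$ is defined by $\alpha=1-\frac2{\nu+d}$, and for $\boldsymbol{\mu}\in\mathbb{R}^d$, $\boldsymbol{\Sigma}=(\sigma_{ij})$ symmetric positive definite of order $d$, $$p_\theta(\mathbf{x})=N_{\theta,\alpha}\big[1+\tfrac1\nu(\mathbf{x}-\boldsymbol{\mu})^\top\boldsymbol{\Sigma}^{-1}(\mathbf{x}-\boldsymbol{\mu})\big]^{\frac1{\alpha-1}},\quad\mathbf{x}\in\mathbb{R}^d,$$ with $N_{\theta,\alpha}$ the normalizing constant and unknown parameter $\theta=[\mu_i,\sigma_{ij}]^\top_{i\le j}$ ($\nu$, i.e. $\alpha$, is known). Its mean is $\boldsymbol{\mu}$ and its covariance matrix is $\boldsymbol{K}=\frac{\nu}{\nu-2}\boldsymbol{\Sigma}$. With $s(\mathbf{x};\theta)=\nabla_\theta\ln p_\theta(\mathbf{x})$, the estimators are the parameter values solving the estimating equations: - Basu et al.: $\frac1n\sum_{j=1}^n p_\theta(\mathbf{X}_j)^{\alpha-1}s(\mathbf{X}_j;\theta)=\int p_\theta(\mathbf{x})^\alpha s(\mathbf{x};\theta)\,d\mathbf{x}$; - Jones et al.: $\dfrac{\frac1n\sum_j p_\theta(\mathbf{X}_j)^{\alpha-1}s(\mathbf{X}_j;\theta)}{\frac1n\sum_j p_\theta(\mathbf{X}_j)^{\alpha-1}}=\dfrac{\int p_\theta(\mathbf{x})^\alpha s(\mathbf{x};\theta)\,d\mathbf{x}}{\int p_\theta(\mathbf{x})^\alpha\,d\mathbf{x}}$.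 *)

theory Defs
  imports "HOL-Probability.Probability"
begin

definition pos_def :: "real ^ 'd ^ 'd \<Rightarrow> bool" where
  "pos_def A \<longleftrightarrow> transpose A = A \<and> (\<forall>x. x \<noteq> 0 \<longrightarrow> x \<bullet> (A *v x) > 0)"

text \<open>
  A parameter \<open>\<theta>\<close> is the pair of the location vector \<open>\<mu>\<close> and the scale matrix \<open>\<Sigma>\<close>.
\<close>

type_synonym 'd student_param = "(real ^ 'd) \<times> (real ^ 'd ^ 'd)"

definition student_kernel :: "real \<Rightarrow> real \<Rightarrow> 'd::finite student_param \<Rightarrow> real ^ 'd \<Rightarrow> real" where
  "student_kernel \<alpha> \<nu> \<theta> x =
     (1 + (1 / \<nu>) * ((x - fst \<theta>) \<bullet> (matrix_inv (snd \<theta>) *v (x - fst \<theta>)))) powr (1 / (\<alpha> - 1))"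

definition student_const :: "real \<Rightarrow> real \<Rightarrow> 'd::finite student_param \<Rightarrow> real" where
  "student_const \<alpha> \<nu> \<theta> = 1 / (LINT x|lborel. student_kernel \<alpha> \<nu> \<theta> x)"

definition student_density :: "real \<Rightarrow> real \<Rightarrow> 'd::finite student_param \<Rightarrow> real ^ 'd \<Rightarrow> real" where
  "student_density \<alpha> \<nu> \<theta> x = student_const \<alpha> \<nu> \<theta> * student_kernel \<alpha> \<nu> \<theta> x"

text \<open>
  The free coordinates of \<open>\<theta>\<close> are \<open>\<mu>\<^sub>i\<close> and \<open>\<sigma>\<^sub>i\<^sub>j\<close> with \<open>i \<le> j\<close>. Since \<open>\<Sigma>\<close> is
  symmetric, varying \<open>\<sigma>\<^sub>i\<^sub>j\<close> changes the entries \<open>(i, j)\<close> and \<open>(j, i)\<close> simultaneously.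
\<close>

datatype 'd coord = Loc 'd | Scale 'd 'd

definition free_coords :: "'d::linorder coord set" where
  "free_coords = range Loc \<union> {Scale i j | i j. i \<le> j}"

fun get_coord :: "'d::finite student_param \<Rightarrow> 'd coord \<Rightarrow> real" where
  "get_coord \<theta> (Loc i) = fst \<theta> $ i"
| "get_coord \<theta> (Scale i j) = snd \<theta> $ i $ j"

fun set_coord :: "'d::finite student_param \<Rightarrow> 'd coord \<Rightarrow> real \<Rightarrow> 'd student_param" where
  "set_coord \<theta> (Loc i) t = ((\<chi> k. if k = i then t else fst \<theta> $ k), snd \<theta>)"
| "set_coord \<theta> (Scale i j) t =
     (fst \<theta>, \<chi> k l. if (k = i \<and> l = j) \<or> (k = j \<and> l = i) then t else snd \<theta> $ k $ l)"

text \<open>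
  The component along the coordinate \<open>c\<close> of the score \<open>s(x; \<theta>)\<close>, the gradient of
  \<open>ln p\<^sub>\<theta>(x)\<close> with respect to \<open>\<theta>\<close>.
\<close>

definition score :: "real \<Rightarrow> real \<Rightarrow> 'd::finite student_param \<Rightarrow> 'd coord \<Rightarrow> real ^ 'd \<Rightarrow> real" where
  "score \<alpha> \<nu> \<theta> c x =
     deriv (\<lambda>t. ln (student_density \<alpha> \<nu> (set_coord \<theta> c t) x)) (get_coord \<theta> c)"

definition basu_equation ::
    "real \<Rightarrow> real \<Rightarrow> nat \<Rightarrow> (nat \<Rightarrow> real ^ 'd::{finite,linorder}) \<Rightarrow> 'd student_param \<Rightarrow> bool" where
  "basu_equation \<alpha> \<nu> n x \<theta> \<longleftrightarrow>
     (\<forall>c \<in> free_coords.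
        (1 / real n) * (\<Sum>r = 1..n. student_density \<alpha> \<nu> \<theta> (x r) powr (\<alpha> - 1) * score \<alpha> \<nu> \<theta> c (x r))
        = (LINT y|lborel. student_density \<alpha> \<nu> \<theta> y powr \<alpha> * score \<alpha> \<nu> \<theta> c y))"

definition jones_equation ::
    "real \<Rightarrow> real \<Rightarrow> nat \<Rightarrow> (nat \<Rightarrow> real ^ 'd::{finite,linorder}) \<Rightarrow> 'd student_param \<Rightarrow> bool" where
  "jones_equation \<alpha> \<nu> n x \<theta> \<longleftrightarrow>
     (\<forall>c \<in> free_coords.
        ((1 / real n) * (\<Sum>r = 1..n. student_density \<alpha> \<nu> \<theta> (x r) powr (\<alpha> - 1) * score \<alpha> \<nu> \<theta> c (x r)))
          / ((1 / real n) * (\<Sum>r = 1..n. student_density \<alpha> \<nu> \<theta> (x r) powr (\<alpha> - 1)))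
        = (LINT y|lborel. student_density \<alpha> \<nu> \<theta> y powr \<alpha> * score \<alpha> \<nu> \<theta> c y)
          / (LINT y|lborel. student_density \<alpha> \<nu> \<theta> y powr \<alpha>))"

text \<open>
  The estimates of \<open>(\<mu>, K)\<close>, with \<open>K = \<nu>/(\<nu> - 2) \<Sigma>\<close>, are the images of the solutions
  \<open>(\<mu>, \<Sigma>)\<close> of the estimating equation in the parameter space. There is no solution if the
  data are too degenerate, so the estimates form a set.
\<close>

definition basu_estimates ::
    "real \<Rightarrow> real \<Rightarrow> nat \<Rightarrow> (nat \<Rightarrow> real ^ 'd::{finite,linorder}) \<Rightarrow> ((real ^ 'd::{finite,linorder}) \<times> (real ^ 'd::{finite,linorder} ^ 'd::{finite,linorder})) set" where
  "basu_estimates \<alpha> \<nu> n x =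
     {(\<mu>, (\<nu> / (\<nu> - 2)) *\<^sub>R \<Sigma>) | \<mu> \<Sigma>. pos_def \<Sigma> \<and> basu_equation \<alpha> \<nu> n x (\<mu>, \<Sigma>)}"

definition jones_estimates ::
    "real \<Rightarrow> real \<Rightarrow> nat \<Rightarrow> (nat \<Rightarrow> real ^ 'd::{finite,linorder}) \<Rightarrow> ((real ^ 'd::{finite,linorder}) \<times> (real ^ 'd::{finite,linorder} ^ 'd::{finite,linorder})) set" where
  "jones_estimates \<alpha> \<nu> n x =
     {(\<mu>, (\<nu> / (\<nu> - 2)) *\<^sub>R \<Sigma>) | \<mu> \<Sigma>. pos_def \<Sigma> \<and> jones_equation \<alpha> \<nu> n x (\<mu>, \<Sigma>)}"

end

(*
  Put u(y) = 1 + (y - \<mu>)^T \<Sigma>^{-1} (y - \<mu>) / \<nu>, so that the density is a constant times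
  u^(1/(\<alpha> - 1)). Hence p^(\<alpha> - 1) is proportional to u, and p^(\<alpha> - 1) times the score is a
  polynomial of degree two in y. Both sides of the estimating equations therefore depend only on
  moments up to order two, those of the sample on one side and those of the model on the other,
  and the equations say that the two sets of moments agree: with m the mean of the deviations
  X_r - \<mu> and S their second moment matrix, the coordinates of \<mu> give \<Sigma>^{-1} m = 0, and the
  coordinates of \<Sigma> give S = a \<Sigma> for a scalar a, which is then identified by taking traces
  against \<Sigma>^{-1}.

  The model moments come from writing (1 + |z|^2)^(-b) as a Gamma mixture of Gaussian kernels.
*)
theory Submission
  imports Defs
begin

text \<open>The exponent 1/(\<alpha> - 1) is -(\<nu> + d)/2, and p^\<alpha> is p times p^(\<alpha> -
  1). So the model side is an integral of a quadratic polynomial against p itself: it is finite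
  because \<nu> > 2, and the second moment matrix that enters is K. This is why the estimate is the
  sample covariance and not a multiple of it. The obstacle is the score, a derivative of a log
  density whose normalizing constant is given as an integral. The substitution y = \<mu> +
  sqrt(\<nu>) B z with B B^T = \<Sigma> shows this integral to be a constant times sqrt(det
  \<Sigma>). Nothing has to be differentiated under an integral sign; only \<Sigma>^{-1} and ln det
  \<Sigma> are differentiated, along lines of symmetric matrices. The scalar a depends on the trace
  of \<Sigma>^{-1} S, because the mean of u does. The trace argument is therefore a fixed-point
  equation for one real unknown, and it takes a different form for the two estimators.\<close>

section \<open>Positive definite matrices\<close>

lemma matrix_vector_mult_inner_transpose:
  fixes A :: "real ^ 'm ^ 'n"
  shows "x \<bullet> (A *v y) = (transpose A *v x) \<bullet> y"
  by (simp add: dot_lmul_matrix[symmetric] transpose_matrix_vector)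

lemma matrix_mult_scaleR: "A ** (c *\<^sub>R B) = c *\<^sub>R (A ** B)" for A :: "real ^ 'm ^ 'n"
  by (simp add: matrix_scalar_ac scalar_matrix_assoc)

lemma matrix_mult_diff_distrib: "A ** (B - C) = A ** B - A ** C" for A :: "real ^ 'n ^ 'n"
  by (simp add: vec_eq_iff matrix_matrix_mult_def right_diff_distrib sum_subtractf)

lemma trace_scaleR: "trace (c *\<^sub>R A) = c * trace A" for A :: "real ^ 'n ^ 'n"
  by (simp add: trace_def sum_distrib_left)

lemma symmetric_component:
  fixes M :: "'a ^ 'n ^ 'n"
  assumes "transpose M = M" shows "M $ i $ j = M $ j $ i"
  using arg_cong[OF assms, of "\<lambda>M. M $ j $ i"] by (simp add: transpose_def)

lemma pos_def_transpose: "pos_def A \<Longrightarrow> transpose A = A"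
  by (simp add: pos_def_def)

lemma pos_def_scaleR:
  fixes A :: "real ^ 'n ^ 'n"
  assumes "c > 0" shows "pos_def (c *\<^sub>R A) \<longleftrightarrow> pos_def A"
  using assms by (auto simp: pos_def_def scaleR_matrix_vector_assoc[symmetric] transpose_def vec_eq_iff zero_less_mult_iff)

lemma pos_def_invertible:
  fixes A :: "real ^ 'n ^ 'n"
  assumes "pos_def A" shows "invertible A"
proof -
  have "A *v x \<noteq> 0" if "x \<noteq> 0" for x
    using assms that by (force simp: pos_def_def)
  then show ?thesis
    by (metis invertible_left_inverse matrix_left_invertible_ker)
qed

lemma pos_def_matrix_inv:
  fixes A :: "real ^ 'n ^ 'n"
  assumes "pos_def A"
  shows pos_def_inv_right: "A ** matrix_inv A = mat 1"
    and pos_def_inv_left: "matrix_inv A ** A = mat 1"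
    and pos_def_inv: "pos_def (matrix_inv A)"
proof -
  let ?P = "matrix_inv A"
  show r: "A ** ?P = mat 1" and l: "?P ** A = mat 1"
    using someI_ex[OF pos_def_invertible[OF assms, unfolded invertible_def]]
    by (auto simp: matrix_inv_def)
  have "transpose ?P = transpose ?P ** (A ** ?P)"
    by (simp add: r)
  also have "\<dots> = transpose (A ** ?P) ** ?P"
    by (simp add: matrix_transpose_mul pos_def_transpose[OF assms] matrix_mul_assoc)
  finally have sym: "transpose ?P = ?P" by (simp add: r)
  have "x \<bullet> (?P *v x) > 0" if "x \<noteq> 0" for x
  proof -
    have x: "x = A *v (?P *v x)" by (simp add: matrix_vector_mul_assoc r)
    with that have "?P *v x \<noteq> 0" by auto
    then have "(?P *v x) \<bullet> (A *v (?P *v x)) > 0"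
      using assms by (auto simp: pos_def_def)
    then show ?thesis by (simp add: x[symmetric] inner_commute)
  qed
  with sym show "pos_def ?P" by (simp add: pos_def_def)
qed

text \<open>Gram-Schmidt for the inner product given by \<open>P\<close>, as an induction over sets
  of indices. Before an index is added there are fewer than CARD('n) vectors
  \<open>P *v v j\<close>, so they do not span the space. A nonzero vector orthogonal to all of them
  exists and only needs rescaling. The columns of \<open>A\<close> are the resulting
  vectors.\<close>

lemma pos_def_orthonormal:
  fixes P :: "real ^ 'n ^ 'n"
  assumes P: "pos_def P"
  obtains A :: "real ^ 'n ^ 'n" where "transpose A ** P ** A = mat 1"
proof -
  have "\<exists>v :: 'n \<Rightarrow> real ^ 'n. \<forall>i\<in>S. \<forall>j\<in>S. v i \<bullet> (P *v v j) = (if i = j then 1 else 0)" for S :: "'n set"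
    using finite[of S]
  proof (induction S rule: finite_induct)
    case (insert i S)
    then obtain v :: "'n \<Rightarrow> real ^ 'n"
      where v: "\<forall>i\<in>S. \<forall>j\<in>S. v i \<bullet> (P *v v j) = (if i = j then 1 else 0)" by blast
    let ?V = "(\<lambda>j. P *v v j) ` S"
    have "dim ?V \<le> card S"
      using dim_le_card'[of ?V] card_image_le[of S "\<lambda>j. P *v v j"] by simp
    also have "card S < CARD('n)"
      using insert.hyps by (intro psubset_card_mono) auto
    finally have "dim ?V < DIM(real ^ 'n)" by simp
    then obtain x where x: "x \<noteq> 0" "\<And>y. y \<in> span ?V \<Longrightarrow> orthogonal x y"
      using orthogonal_to_subspace_exists by blast
    have q: "x \<bullet> (P *v x) > 0" using P x(1) by (simp add: pos_def_def)
    have o: "x \<bullet> (P *v v j) = 0" if "j \<in> S" for j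
      using x(2)[of "P *v v j"] that by (auto intro: span_base simp: orthogonal_def)
    have o': "v j \<bullet> (P *v x) = 0" if "j \<in> S" for j
      using o[OF that] by (metis inner_commute matrix_vector_mult_inner_transpose pos_def_transpose[OF P])
    define w where "w = (1 / sqrt (x \<bullet> (P *v x))) *\<^sub>R x"
    have "w \<bullet> (P *v w) = 1"
      using q by (simp add: w_def vec.scale matrix_vector_mult_scaleR power2_eq_square[symmetric] divide_simps)
    then have "\<forall>k\<in>insert i S. \<forall>j\<in>insert i S.
        (v(i := w)) k \<bullet> (P *v (v(i := w)) j) = (if k = j then 1 else 0)"
      using v insert.hyps(2) o o' by (auto simp: w_def matrix_vector_mult_scaleR)
    then show ?case by blast
  qed simp
  from this[of UNIV] obtain v :: "'n \<Rightarrow> real ^ 'n"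
    where v: "\<And>i j. v i \<bullet> (P *v v j) = (if i = j then 1 else 0)" by auto
  define A :: "real ^ 'n ^ 'n" where "A = (\<chi> k i. v i $ k)"
  have "(transpose A ** P ** A) $ i $ j = v i \<bullet> (P *v v j)" for i j
    by (simp add: matrix_mul_assoc[symmetric])
       (simp add: A_def matrix_matrix_mult_def matrix_vector_mult_def transpose_def inner_vec_def)
  then have "transpose A ** P ** A = mat 1"
    by (simp add: vec_eq_iff v mat_def)
  then show ?thesis by (rule that)
qed

text \<open>Orthonormality for the inverse of \<Sigma> says that \<open>transpose A\<close> is a
  one-sided inverse of \<open>matrix_inv \<Sigma> ** A\<close>. One-sided inverses of square
  matrices are two-sided, and this gives \<open>A ** transpose A = \<Sigma>\<close>. The factor
  \<open>A\<close> later standardizes the Student kernel.\<close>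

lemma pos_def_factor:
  fixes \<Sigma> :: "real ^ 'n ^ 'n"
  assumes "pos_def \<Sigma>"
  obtains A :: "real ^ 'n ^ 'n" where "transpose A ** matrix_inv \<Sigma> ** A = mat 1" "A ** transpose A = \<Sigma>"
    "det \<Sigma> = (det A)\<^sup>2" "det A \<noteq> 0"
proof -
  let ?P = "matrix_inv \<Sigma>"
  obtain A :: "real ^ 'n ^ 'n" where A: "transpose A ** ?P ** A = mat 1"
    using pos_def_orthonormal[OF pos_def_inv[OF assms]] .
  then have "(?P ** A) ** transpose A = mat 1"
    by (metis matrix_left_right_inverse matrix_mul_assoc)
  then have "\<Sigma> ** (?P ** (A ** transpose A)) = \<Sigma>"
    by (simp add: matrix_mul_assoc)
  then have AA: "A ** transpose A = \<Sigma>"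
    by (simp add: matrix_mul_assoc pos_def_inv_right[OF assms])
  have "det (transpose A ** ?P ** A) = 1" by (simp add: A)
  then have "det A \<noteq> 0" by (auto simp: det_mul)
  moreover have "det \<Sigma> = (det A)\<^sup>2"
    by (simp add: AA[symmetric] det_mul power2_eq_square)
  ultimately show ?thesis using that A AA by blast
qed

lemma pos_def_det_pos: "pos_def \<Sigma> \<Longrightarrow> det \<Sigma> > 0" for \<Sigma> :: "real ^ 'n ^ 'n"
  by (erule pos_def_factor) simp

text \<open>The constant is the minimum of the quadratic form on the compact unit sphere;
  homogeneity of degree two carries the bound to all vectors.\<close>

lemma pos_def_coercive:
  fixes \<Sigma> :: "real ^ 'n ^ 'n"
  assumes "pos_def \<Sigma>"
  obtains c where "c > 0" "\<And>x. x \<bullet> (\<Sigma> *v x) \<ge> c * (norm x)\<^sup>2"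
proof -
  have ne: "sphere (0 :: real ^ 'n) 1 \<noteq> {}" by simp
  have "continuous_on (sphere 0 1) (\<lambda>x. x \<bullet> (\<Sigma> *v x))"
    by (intro continuous_intros linear_continuous_on matrix_vector_mul_bounded_linear)
  then obtain u where u: "u \<in> sphere 0 1" "\<And>x. x \<in> sphere 0 1 \<Longrightarrow> u \<bullet> (\<Sigma> *v u) \<le> x \<bullet> (\<Sigma> *v x)"
    using continuous_attains_inf[OF compact_sphere ne] by blast
  have "u \<noteq> 0" using u(1) by auto
  then have "u \<bullet> (\<Sigma> *v u) > 0" using assms by (simp add: pos_def_def)
  moreover have "x \<bullet> (\<Sigma> *v x) \<ge> u \<bullet> (\<Sigma> *v u) * (norm x)\<^sup>2" for x
  proof (cases "x = 0")
    case False
    have "u \<bullet> (\<Sigma> *v u) \<le> ((1 / norm x) *\<^sub>R x) \<bullet> (\<Sigma> *v ((1 / norm x) *\<^sub>R x))"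
      using False by (intro u(2)) simp
    then show ?thesis
      using False by (simp add: matrix_vector_mult_scaleR power2_eq_square field_simps)
  qed simp
  ultimately show ?thesis by (rule that)
qed

section \<open>Derivatives of the inverse and of the log determinant along a line\<close>

text \<open>Two things are needed near h = 0: the line stays in the parameter space, and one
  coercivity constant serves all small h, so that the inverses are uniformly bounded.\<close>

lemma eventually_pos_def:
  fixes \<Sigma> E :: "real ^ 'n ^ 'n"
  assumes "pos_def \<Sigma>" "transpose E = E"
  obtains c where "c > 0" "\<forall>\<^sub>F h in nhds 0. pos_def (\<Sigma> + h *\<^sub>R E) \<and>
     (\<forall>x. x \<bullet> ((\<Sigma> + h *\<^sub>R E) *v x) \<ge> c * (norm x)\<^sup>2)"
proof -
  obtain c where c: "c > 0" "\<And>x. x \<bullet> (\<Sigma> *v x) \<ge> c * (norm x)\<^sup>2"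
    using pos_def_coercive[OF assms(1)] by blast
  obtain K where K: "K > 0" "\<And>x. norm (E *v x) \<le> norm x * K"
    using bounded_linear.pos_bounded[OF matrix_vector_mul_bounded_linear[of E]] by blast
  \<comment> \<open>Below this threshold the perturbation costs at most c/2 times the squared norm,
    which leaves half of the coercivity constant.\<close>
  have "pos_def (\<Sigma> + h *\<^sub>R E) \<and> (\<forall>x. x \<bullet> ((\<Sigma> + h *\<^sub>R E) *v x) \<ge> c / 2 * (norm x)\<^sup>2)"
    if "\<bar>h\<bar> < c / (2 * K)" for h
  proof -
    have *: "x \<bullet> ((\<Sigma> + h *\<^sub>R E) *v x) \<ge> c / 2 * (norm x)\<^sup>2" for x
    proof -
      have "\<bar>x \<bullet> (E *v x)\<bar> \<le> norm x * (norm x * K)"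
        using Cauchy_Schwarz_ineq2[of x "E *v x"] mult_left_mono[OF K(2)[of x], of "norm x"] by simp
      then have "\<bar>h * (x \<bullet> (E *v x))\<bar> \<le> \<bar>h\<bar> * (norm x * (norm x * K))"
        by (simp add: abs_mult mult_left_mono)
      also have "\<dots> \<le> c / (2 * K) * (norm x * (norm x * K))"
        using that K(1) by (intro mult_right_mono) auto
      also have "\<dots> = c / 2 * (norm x)\<^sup>2"
        using K(1) by (simp add: power2_eq_square)
      finally show ?thesis
        using c(2)[of x] by (simp add: matrix_vector_mult_add_rdistrib scaleR_matrix_vector_assoc[symmetric] inner_add_right abs_le_iff)
    qed
    have "x \<bullet> ((\<Sigma> + h *\<^sub>R E) *v x) > 0" if "x \<noteq> 0" for x
      using c(1) that by (intro less_le_trans[OF _ *]) simp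
    moreover have "transpose (\<Sigma> + h *\<^sub>R E) = \<Sigma> + h *\<^sub>R E"
      using assms pos_def_transpose[OF assms(1)] by (simp add: vec_eq_iff transpose_def)
    ultimately show ?thesis using * by (simp add: pos_def_def)
  qed
  moreover have "\<forall>\<^sub>F h in nhds 0. \<bar>h\<bar> < c / (2 * K)"
    using c(1) K(1) by (auto simp: eventually_nhds_metric dist_real_def intro!: exI[of _ "c / (2 * K)"])
  ultimately have "\<forall>\<^sub>F h in nhds 0. pos_def (\<Sigma> + h *\<^sub>R E) \<and>
     (\<forall>x. x \<bullet> ((\<Sigma> + h *\<^sub>R E) *v x) \<ge> c / 2 * (norm x)\<^sup>2)"
    by (auto elim: eventually_mono)
  with c(1) show ?thesis by (intro that[of "c / 2"]) auto
qed

text \<open>The resolvent identity G(h) - G(0) = -h G(h) E G(0) reduces differentiability to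
  continuity of G at 0. The same identity gives the continuity, since coercivity bounds G(h) by 1/c
  uniformly.\<close>

lemma has_derivative_matrix_inv_line:
  fixes \<Sigma> E :: "real ^ 'n ^ 'n"
  assumes S: "pos_def \<Sigma>" and E: "transpose E = E"
  shows "((\<lambda>h. w \<bullet> (matrix_inv (\<Sigma> + h *\<^sub>R E) *v y)) has_real_derivative
     - ((matrix_inv \<Sigma> *v w) \<bullet> (E *v (matrix_inv \<Sigma> *v y)))) (at 0)"
proof -
  let ?G = "\<lambda>h. matrix_inv (\<Sigma> + h *\<^sub>R E)" and ?P = "matrix_inv \<Sigma>"
  obtain c where c: "c > 0" and ev: "\<forall>\<^sub>F h in nhds 0. pos_def (\<Sigma> + h *\<^sub>R E) \<and>
     (\<forall>x. x \<bullet> ((\<Sigma> + h *\<^sub>R E) *v x) \<ge> c * (norm x)\<^sup>2)"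
    using eventually_pos_def[OF S E] .
  have G_diff: "?G h *v y - ?P *v y = - h *\<^sub>R (?G h *v (E *v (?P *v y)))"
    if "pos_def (\<Sigma> + h *\<^sub>R E)" for h y
  proof -
    have "\<Sigma> *v (?P *v y) = y"
      by (simp add: matrix_vector_mul_assoc pos_def_inv_right[OF S])
    moreover have "?G h *v ((\<Sigma> + h *\<^sub>R E) *v (?P *v y)) = ?P *v y"
      by (metis matrix_vector_mul_assoc matrix_vector_mul_lid pos_def_inv_left[OF that])
    ultimately have "?G h *v y - ?P *v y =
        ?G h *v (\<Sigma> *v (?P *v y)) - ?G h *v ((\<Sigma> + h *\<^sub>R E) *v (?P *v y))"
      by simp
    also have "\<dots> = - h *\<^sub>R (?G h *v (E *v (?P *v y)))"
      by (simp add: matrix_vector_mult_add_rdistrib scaleR_matrix_vector_assoc[symmetric] matrix_vector_right_distrib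
          matrix_vector_mult_scaleR)
    finally show ?thesis .
  qed
  have G_bound: "norm (?G h *v y) \<le> norm y / c"
    if "pos_def (\<Sigma> + h *\<^sub>R E)" "\<forall>x. x \<bullet> ((\<Sigma> + h *\<^sub>R E) *v x) \<ge> c * (norm x)\<^sup>2" for h y
  proof -
    let ?x = "?G h *v y"
    have "c * (norm ?x)\<^sup>2 \<le> ?x \<bullet> y"
      using that(2)[rule_format, of ?x] by (simp add: matrix_vector_mul_assoc pos_def_inv_right[OF that(1)])
    also have "\<dots> \<le> norm ?x * norm y" by (rule norm_cauchy_schwarz)
    finally have "norm ?x * (c * norm ?x) \<le> norm ?x * norm y" by (simp add: power2_eq_square mult_ac)
    then have "c * norm ?x \<le> norm y" by (cases "?x = 0") auto
    then show ?thesis using c by (simp add: field_simps)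
  qed
  have lim: "((\<lambda>h. ?G h *v w) \<longlongrightarrow> ?P *v w) (at 0)"
  proof (rule Lim_transform_bound[of "\<lambda>h. ?G h *v w - ?P *v w" "\<lambda>h. \<bar>h\<bar> * (norm (E *v (?P *v w)) / c)", THEN LIM_zero_cancel])
    show "\<forall>\<^sub>F h in at 0. norm (?G h *v w - ?P *v w) \<le> norm (\<bar>h\<bar> * (norm (E *v (?P *v w)) / c))"
      using filter_leD[OF at_within_le_nhds ev]
    proof (rule eventually_mono)
      fix h assume "pos_def (\<Sigma> + h *\<^sub>R E) \<and> (\<forall>x. x \<bullet> ((\<Sigma> + h *\<^sub>R E) *v x) \<ge> c * (norm x)\<^sup>2)"
      then show "norm (?G h *v w - ?P *v w) \<le> norm (\<bar>h\<bar> * (norm (E *v (?P *v w)) / c))"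
        using c mult_left_mono[OF G_bound[of h "E *v (?P *v w)"], of "\<bar>h\<bar>"] by (simp add: G_diff abs_mult)
    qed
    show "((\<lambda>h. \<bar>h\<bar> * (norm (E *v (?P *v w)) / c)) \<longlongrightarrow> 0) (at 0)"
      by (rule tendsto_eq_rhs, (rule tendsto_intros)+) simp
  qed
  \<comment> \<open>The difference quotient equals this expression exactly for small nonzero h,
    because \<open>?G h\<close> is symmetric and can be moved to the other side of the inner
    product.\<close>
  have "((\<lambda>h. - ((?G h *v w) \<bullet> (E *v (?P *v y)))) \<longlongrightarrow> - ((?P *v w) \<bullet> (E *v (?P *v y)))) (at 0)"
    by (intro tendsto_intros lim)
  moreover have "\<forall>\<^sub>F h in at 0. - ((?G h *v w) \<bullet> (E *v (?P *v y))) =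
      (w \<bullet> (?G (0 + h) *v y) - w \<bullet> (?G 0 *v y)) / h"
    using filter_leD[OF at_within_le_nhds ev] eventually_neq_at_within[of 0]
  proof eventually_elim
    case (elim h)
    then have p: "pos_def (\<Sigma> + h *\<^sub>R E)" by simp
    have "w \<bullet> (?G h *v y) - w \<bullet> (?P *v y) = - h * (w \<bullet> (?G h *v (E *v (?P *v y))))"
      by (simp add: inner_diff_right[symmetric] G_diff[OF p])
    also have "\<dots> = - h * ((?G h *v w) \<bullet> (E *v (?P *v y)))"
      by (simp add: matrix_vector_mult_inner_transpose[of w] pos_def_transpose[OF pos_def_inv[OF p]])
    finally show ?case using elim by simp
  qed
  ultimately show ?thesis unfolding DERIV_def by (rule Lim_transform_eventually)
qed

text \<open>In the Leibniz expansion only the identity permutation survives. Any other permutation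
  moves at least two indices, so after one factor has been differentiated an off-diagonal entry of
  the identity matrix remains in the product.\<close>

lemma has_real_derivative_det_id:
  fixes F :: "real ^ 'n ^ 'n"
  shows "((\<lambda>h. det (mat 1 + h *\<^sub>R F)) has_real_derivative trace F) (at 0)"
proof -
  let ?e = "\<lambda>(p :: 'n \<Rightarrow> 'n) i h. (mat 1 + h *\<^sub>R F) $ i $ p i"
  have d: "((\<lambda>h. det (mat 1 + h *\<^sub>R F)) has_real_derivative
      (\<Sum>p | p permutes UNIV. of_int (sign p) * (\<Sum>i\<in>UNIV. F $ i $ p i * (\<Prod>j\<in>UNIV - {i}. ?e p j 0)))) (at 0)"
    unfolding det_def
    by (intro DERIV_sum DERIV_cmult has_field_derivative_prod) (auto intro!: derivative_eq_intros)
  have z: "(\<Sum>i\<in>UNIV. F $ i $ p i * (\<Prod>j\<in>UNIV - {i}. ?e p j 0)) = (if p = id then trace F else 0)"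
    if p: "p permutes UNIV" for p
  proof (cases "p = id")
    case True
    then show ?thesis by (simp add: trace_def mat_def)
  next
    case False
    then obtain k where k: "p k \<noteq> k" unfolding fun_eq_iff id_def by blast
    \<comment> \<open>The second moved index is \<open>p k\<close>; it supplies the vanishing factor
      when the differentiated one is \<open>k\<close> itself.\<close>
    have pk: "p (p k) \<noteq> p k" using k inj_eq[OF permutes_inj[OF p]] by simp
    have "(\<Prod>j\<in>UNIV - {i}. ?e p j 0) = 0" for i
    proof (cases "k = i")
      case False
      then show ?thesis using k by (intro prod_zero) (auto simp: mat_def intro!: bexI[of _ k])
    next
      case True
      then show ?thesis using k pk by (intro prod_zero) (auto simp: mat_def intro!: bexI[of _ "p k"])
    qed
    then have "F $ i $ p i * (\<Prod>j\<in>UNIV - {i}. ?e p j 0) = 0" for i by simp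
    then show ?thesis using False by (simp only: sum.neutral_const if_False)
  qed
  have "(\<Sum>p | p permutes UNIV. of_int (sign p) * (\<Sum>i\<in>UNIV. F $ i $ p i * (\<Prod>j\<in>UNIV - {i}. ?e p j 0)))
      = (\<Sum>p :: 'n \<Rightarrow> 'n | p permutes UNIV. if p = id then trace F else 0)"
  proof (rule sum.cong[OF refl])
    fix p :: "'n \<Rightarrow> 'n" assume "p \<in> {p. p permutes UNIV}"
    then have p: "p permutes UNIV" by simp
    show "of_int (sign p) * (\<Sum>i\<in>UNIV. F $ i $ p i * (\<Prod>j\<in>UNIV - {i}. ?e p j 0)) =
        (if p = id then trace F else 0)"
      by (subst z[OF p]) simp
  qed
  also have "\<dots> = trace F"
    by (simp add: sum.delta finite_permutations permutes_id)
  finally show ?thesis using d by (simp only:)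
qed

text \<open>Jacobi's formula: factoring \<Sigma> out of the determinant moves the base point of the
  line to the identity.\<close>

lemma has_real_derivative_ln_det_line:
  fixes \<Sigma> E :: "real ^ 'n ^ 'n"
  assumes S: "pos_def \<Sigma>"
  shows "((\<lambda>h. ln (det (\<Sigma> + h *\<^sub>R E))) has_real_derivative trace (matrix_inv \<Sigma> ** E)) (at 0)"
proof -
  have eq: "det (\<Sigma> + h *\<^sub>R E) = det \<Sigma> * det (mat 1 + h *\<^sub>R (matrix_inv \<Sigma> ** E))" for h
  proof -
    have "\<Sigma> ** (mat 1 + h *\<^sub>R (matrix_inv \<Sigma> ** E)) = \<Sigma> + h *\<^sub>R ((\<Sigma> ** matrix_inv \<Sigma>) ** E)"
      by (simp add: matrix_add_ldistrib matrix_mul_assoc matrix_mult_scaleR)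
    then show ?thesis by (simp add: pos_def_inv_right[OF S] det_mul[symmetric])
  qed
  have "((\<lambda>h. det (\<Sigma> + h *\<^sub>R E)) has_real_derivative det \<Sigma> * trace (matrix_inv \<Sigma> ** E)) (at 0)"
    unfolding eq by (intro DERIV_cmult has_real_derivative_det_id)
  then have "((\<lambda>h. ln (det (\<Sigma> + h *\<^sub>R E))) has_real_derivative
      1 / det \<Sigma> * (det \<Sigma> * trace (matrix_inv \<Sigma> ** E))) (at 0)"
    using DERIV_ln_divide[of "det \<Sigma>"] pos_def_det_pos[OF S]
    by (intro DERIV_chain2[where f = ln and g = "\<lambda>h. det (\<Sigma> + h *\<^sub>R E)"]) simp_all
  then show ?thesis using pos_def_det_pos[OF S] by simp
qed

section \<open>Linear change of variables\<close>

text \<open>The image of Lebesgue measure under the inverse of \<open>f\<close> agrees with it on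
  boxes, hence everywhere. This serves the volume-preserving elementary matrices, namely swaps and
  shears.\<close>

lemma nn_integral_lborel_linear_unimodular:
  fixes f :: "'a::euclidean_space \<Rightarrow> 'a"
  assumes f: "linear f" "inj f"
    and m: "\<And>a b. measure lebesgue (f ` cbox a b) = measure lebesgue (cbox a b)"
    and h: "h \<in> borel_measurable borel"
  shows "(\<integral>\<^sup>+z. h (f z) \<partial>lborel) = (\<integral>\<^sup>+z. h z \<partial>lborel)"
proof -
  have f_meas [measurable]: "f \<in> borel_measurable borel"
    using f(1) by (simp add: borel_measurable_continuous_onI linear_continuous_on linear_linear)
  obtain g where g: "linear g" "\<And>x. g (f x) = x" "\<And>x. f (g x) = x"
    using linear_injective_isomorphism[OF f] by blast
  have g_meas [measurable]: "g \<in> borel_measurable borel"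
    using g(1) by (simp add: borel_measurable_continuous_onI linear_continuous_on linear_linear)
  have "lborel = distr lborel borel g"
  proof (rule lborel_eqI)
    fix l u :: 'a assume lu: "\<And>b. b \<in> Basis \<Longrightarrow> l \<bullet> b \<le> u \<bullet> b"
    have img: "g -` box l u = f ` box l u"
      using g(2,3) by (auto simp: image_iff) metis
    have B: "box l u \<in> lmeasurable" by simp
    have "f ` box l u \<in> lmeasurable \<and> 1 * measure lebesgue (box l u) = measure lebesgue (f ` box l u)"
      by (rule measure_linear_sufficient[OF f(1) B]) (simp add: m)
    moreover have fb: "f ` box l u \<in> sets borel"
      using measurable_sets[OF g_meas, of "box l u"] by (simp add: img)
    ultimately have "emeasure lebesgue (f ` box l u) = emeasure lebesgue (box l u)"
      using B by (simp add: emeasure_eq_measure2)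
    also have "emeasure lebesgue (box l u) = emeasure lborel (box l u)"
      by (simp add: emeasure_completion)
    also have "emeasure lebesgue (f ` box l u) = emeasure lborel (f ` box l u)"
      using fb by simp
    finally show "emeasure (distr lborel borel g) (box l u) = (\<Prod>b\<in>Basis. (u - l) \<bullet> b)"
      using lu by (simp add: emeasure_distr img)
  qed simp
  then have "(\<integral>\<^sup>+z. h (f z) \<partial>lborel) = (\<integral>\<^sup>+z. h (f z) \<partial>distr lborel borel g)" by simp
  also have "\<dots> = (\<integral>\<^sup>+z. h z \<partial>lborel)"
    using h by (subst nn_integral_distr) (auto simp: g)
  finally show ?thesis .
qed

lemma borel_measurable_matrix_vector_mult [measurable]:
  "(*v) (A :: real ^ 'n ^ 'm) \<in> borel_measurable borel"
  by (intro borel_measurable_continuous_onI linear_continuous_on matrix_vector_mul_bounded_linear)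

text \<open>The library's \<open>measure_linear_image\<close> requires a well-ordered index type.\<close>

lemma nn_integral_lborel_matrix:
  fixes A :: "real ^ 'n ^ 'n"
  assumes "det A \<noteq> 0" "h \<in> borel_measurable borel"
  shows "(\<integral>\<^sup>+z. h z \<partial>lborel) = ennreal \<bar>det A\<bar> * (\<integral>\<^sup>+z. h (A *v z) \<partial>lborel)"
proof -
  have "det A \<noteq> 0 \<longrightarrow> (\<forall>h\<in>borel_measurable borel.
      (\<integral>\<^sup>+z. h z \<partial>lborel) = ennreal \<bar>det A\<bar> * (\<integral>\<^sup>+z. h (A *v z) \<partial>lborel))" (is "?P A")
  \<comment> \<open>The formula is multiplicative in the matrix, like the determinant, so elementary
    factors suffice. The premise on the determinant disposes of matrices with a zero row.\<close>
  proof (induction rule: induct_matrix_elementary_alt)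
    case (1 A B)
    show ?case
    proof (intro impI ballI)
      fix h :: "real ^ 'n \<Rightarrow> ennreal" assume [measurable]: "h \<in> borel_measurable borel"
      assume "det (A ** B) \<noteq> 0"
      then have d: "det A \<noteq> 0" "det B \<noteq> 0" by (auto simp: det_mul)
      have "(\<integral>\<^sup>+z. h z \<partial>lborel) = ennreal \<bar>det A\<bar> * (\<integral>\<^sup>+z. h (A *v z) \<partial>lborel)"
        using d by (intro 1(1)[rule_format]) simp_all
      also have "(\<integral>\<^sup>+z. h (A *v z) \<partial>lborel) = ennreal \<bar>det B\<bar> * (\<integral>\<^sup>+z. h (A *v (B *v z)) \<partial>lborel)"
        using d by (intro 1(2)[rule_format]) simp_all
      finally show "(\<integral>\<^sup>+z. h z \<partial>lborel) = ennreal \<bar>det (A ** B)\<bar> * (\<integral>\<^sup>+z. h (A ** B *v z) \<partial>lborel)"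
        by (simp add: det_mul abs_mult ennreal_mult matrix_vector_mul_assoc mult.assoc)
    qed
  next
    case (2 A i)
    then have "det A = 0" by (simp add: det_zero_row(2))
    then show ?case by simp
  next
    case (3 A)
    show ?case
    proof (intro impI ballI)
      fix h :: "real ^ 'n \<Rightarrow> ennreal" assume [measurable]: "h \<in> borel_measurable borel"
      assume d: "det A \<noteq> 0"
      define c where "c j = (A *v j) \<bullet> j" for j
      have Basis: "(Basis :: (real ^ 'n) set) = range (\<lambda>i. axis i 1)"
        by (auto simp: Basis_vec_def)
      have inj: "inj (\<lambda>i :: 'n. axis i (1 :: real))"
        by (auto simp: inj_def axis_eq_axis)
      have mv: "(A *v z) $ i = A $ i $ i * z $ i" for z i
      proof -
        have "(A *v z) $ i = (\<Sum>j\<in>UNIV. if j = i then A $ i $ i * z $ i else 0)"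
          unfolding matrix_vector_mult_def vec_lambda_beta using 3 by (intro sum.cong) auto
        then show ?thesis by simp
      qed
      have cax: "c (axis i 1) = A $ i $ i" for i
        by (simp add: c_def inner_axis mv)
      have det: "det A = (\<Prod>j\<in>Basis. c j)"
        by (simp add: det_diagonal[OF 3] Basis prod.reindex[OF inj] cax)
      \<comment> \<open>A diagonal matrix rescales each basis direction; this is the form in which
        \<open>lborel_affine_euclidean\<close> expects the map.\<close>
      have T: "A *v z = 0 + (\<Sum>j\<in>Basis. (c j * (z \<bullet> j)) *\<^sub>R j)" for z
      proof (rule euclidean_eqI)
        fix b :: "real ^ 'n" assume b: "b \<in> Basis"
        then obtain i where i: "b = axis i 1" unfolding Basis by blast
        have "(0 + (\<Sum>j\<in>Basis. (c j * (z \<bullet> j)) *\<^sub>R j)) \<bullet> b = c b * (z \<bullet> b)"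
          using b by (simp add: inner_sum_left inner_Basis if_distrib cong: if_cong)
        then show "(A *v z) \<bullet> b = (0 + (\<Sum>j\<in>Basis. (c j * (z \<bullet> j)) *\<^sub>R j)) \<bullet> b"
          by (simp add: i cax inner_axis mv)
      qed
      have nz: "c j \<noteq> 0" if "j \<in> Basis" for j using that d by (simp add: det)
      have "(*v) A = (\<lambda>z. 0 + (\<Sum>j\<in>Basis. (c j * (z \<bullet> j)) *\<^sub>R j))"
        using T by (rule ext)
      then have "lborel = density (distr lborel borel ((*v) A)) (\<lambda>_. \<bar>det A\<bar>)"
        using lborel_affine_euclidean[of c 0, OF nz] by (simp only: det abs_prod)
      then have "(\<integral>\<^sup>+z. h z \<partial>lborel) = (\<integral>\<^sup>+z. h z \<partial>density (distr lborel borel ((*v) A)) (\<lambda>_. \<bar>det A\<bar>))"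
        by simp
      also have "\<dots> = ennreal \<bar>det A\<bar> * (\<integral>\<^sup>+z. h (A *v z) \<partial>lborel)"
        by (simp add: nn_integral_density nn_integral_distr nn_integral_cmult)
      finally show "(\<integral>\<^sup>+z. h z \<partial>lborel) = ennreal \<bar>det A\<bar> * (\<integral>\<^sup>+z. h (A *v z) \<partial>lborel)" .
    qed
  next
    case (4 m n)
    let ?A = "(\<chi> i j. mat 1 $ i $ Transposition.transpose m n j) :: real ^ 'n ^ 'n"
    let ?f = "\<lambda>x::real ^ 'n. \<chi> i. x $ Transposition.transpose m n i"
    have A: "?A *v x = ?f x" for x :: "real ^ 'n"
    proof -
      have "(?A *v x) $ i = (\<Sum>j\<in>UNIV. if j = Transposition.transpose m n i then x $ j else 0)" for i
        unfolding matrix_vector_mult_def vec_lambda_beta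
        by (intro sum.cong) (auto simp: mat_def)
      then show ?thesis by (simp add: vec_eq_iff)
    qed
    have d: "\<bar>det ?A\<bar> = 1"
      by (simp add: det_permute_columns permutes_swap_id sign_swap_id abs_mult)
    have f: "linear ?f"
      by (rule linearI) (simp_all add: plus_vec_def scaleR_vec_def)
    have "x = y" if "?f x = ?f y" for x y
      using that by (metis (no_types, lifting) transpose_involutory vec_eq_iff vec_lambda_beta)
    then have i: "inj ?f" by (auto simp: inj_def)
    have m: "measure lebesgue (?f ` cbox a b) = measure lebesgue (cbox a b)" for a b
    proof (cases "cbox a b = {}")
      case False
      have eq: "?f ` cbox a b = cbox (?f a) (?f b)"
      proof (intro equalityI subsetI)
        fix x assume x: "x \<in> cbox (?f a) (?f b)"
        have "x = ?f (?f x)" by (simp add: vec_eq_iff)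
        moreover have "?f x \<in> cbox a b"
          using x unfolding mem_box_cart by (metis (no_types, lifting) transpose_involutory vec_lambda_beta)
        ultimately show "x \<in> ?f ` cbox a b" by blast
      qed (auto simp: mem_box_cart)
      with False have "cbox (?f a) (?f b) \<noteq> {}" by (metis image_is_empty)
      then show ?thesis
        using False prod.permute[OF permutes_swap_id, where S=UNIV and g="\<lambda>i. (b - a)$i", symmetric]
        by (simp add: eq content_cbox_cart)
    qed simp
    show ?case
      unfolding A d using nn_integral_lborel_linear_unimodular[OF f i m] by simp
  next
    case (5 m n)
    let ?A = "(\<chi> i j. of_bool (i = m \<and> j = n \<or> i = j)) :: real ^ 'n ^ 'n"
    let ?f = "\<lambda>x::real ^ 'n. \<chi> i. if i = m then x $ m + x $ n else x $ i"
    have A: "?A *v x = ?f x" for x :: "real ^ 'n"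
    proof -
      have "(?A *v x) $ i = (\<Sum>j\<in>UNIV. (if j = i then x $ j else 0) + (if j = n then if i = m then x $ j else 0 else 0))" for i
        unfolding matrix_vector_mult_def vec_lambda_beta
        using 5 by (intro sum.cong) auto
      then show ?thesis by (simp add: vec_eq_iff sum.distrib)
    qed
    have "?A = (\<chi> k. if k = m then row m (mat 1) + 1 *s row n (mat 1) else row k (mat 1))"
      using 5 by (auto simp: vec_eq_iff row_def mat_def)
    then have d: "det ?A = 1"
      using det_row_operation[OF 5, of "mat 1" 1] by simp
    have f: "linear ?f"
      by (rule linearI) (simp_all add: vec_eq_iff algebra_simps)
    have "x = y" if "?f x = ?f y" for x y
    proof -
      have eq: "(if i = m then x $ m + x $ n else x $ i) = (if i = m then y $ m + y $ n else y $ i)" for i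
        using that by (simp add: vec_eq_iff)
      have "x $ i = y $ i" for i
        using eq[of n] eq[of i] 5 by (cases "i = m") auto
      then show ?thesis by (simp add: vec_eq_iff)
    qed
    then have i: "inj ?f" by (auto simp: inj_def)
    have m: "measure lebesgue (?f ` cbox a b) = measure lebesgue (cbox a b)" for a b
    proof (cases "cbox a b = {}")
      case False
      \<comment> \<open>Shifting by \<open>t\<close> moves the lower end of the box in coordinate
        \<open>n\<close> to 0, since \<open>measure_shear_interval\<close> requires it to be
        nonnegative. Translations do not change the measure.\<close>
      define t :: "real ^ 'n" where "t = (\<chi> i. if i = n then a $ n else 0)"
      have cb: "cbox a b = (+) t ` cbox (a - t) (b - t)"
        by (simp add: cbox_translation[symmetric])
      with False have "cbox (a - t) (b - t) \<noteq> {}" by (metis image_is_empty)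
      moreover have "?f ` cbox a b = (+) (?f t) ` ?f ` cbox (a - t) (b - t)"
        by (simp only: cb image_image linear_add[OF f])
      ultimately show ?thesis
        using measure_shear_interval[OF 5, of "a - t" "b - t"]
        by (simp add: cb measure_translation) (simp add: t_def measure_translation)
    qed simp
    show ?case
      unfolding A d using nn_integral_lborel_linear_unimodular[OF f i m] by simp
  qed
  with assms show ?thesis by blast
qed

text \<open>The substitution rule for indicators, read as an identity of measures. In this form it
  also applies to functions of varying sign.\<close>

lemma lborel_matrix_affine:
  fixes A :: "real ^ 'n ^ 'n"
  assumes "det A \<noteq> 0"
  shows "lborel = density (distr lborel borel (\<lambda>z. \<mu> + A *v z)) (\<lambda>_. ennreal \<bar>det A\<bar>)"
proof (rule measure_eqI)
  fix S :: "(real ^ 'n) set" assume "S \<in> sets lborel"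
  then have [measurable]: "S \<in> sets borel" by simp
  have "emeasure lborel S = (\<integral>\<^sup>+z. indicator S z \<partial>lborel)" by simp
  also have "\<dots> = (\<integral>\<^sup>+z. indicator S z \<partial>distr lborel borel ((+) \<mu>))"
    by (simp only: lborel_distr_plus)
  also have "\<dots> = (\<integral>\<^sup>+z. indicator S (\<mu> + z) \<partial>lborel)"
    by (rule nn_integral_distr) simp_all
  also have "\<dots> = ennreal \<bar>det A\<bar> * (\<integral>\<^sup>+z. indicator S (\<mu> + A *v z) \<partial>lborel)"
    by (subst nn_integral_lborel_matrix[OF assms]) simp_all
  also have "\<dots> = emeasure (density (distr lborel borel (\<lambda>z. \<mu> + A *v z)) (\<lambda>_. ennreal \<bar>det A\<bar>)) S"
    by (subst emeasure_density) (simp_all add: nn_integral_distr nn_integral_cmult del: nn_integral_indicator)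
  finally show "emeasure lborel S = \<dots>" .
qed simp

lemma has_bochner_integral_lborel_matrix_affine:
  fixes A :: "real ^ 'n ^ 'n" and h :: "real ^ 'n \<Rightarrow> real"
  assumes "det A \<noteq> 0" "h \<in> borel_measurable borel"
    and "has_bochner_integral lborel (\<lambda>z. h (\<mu> + A *v z)) I"
  shows "has_bochner_integral lborel h (\<bar>det A\<bar> * I)"
proof -
  have "has_bochner_integral lborel (\<lambda>z. \<bar>det A\<bar> * h (\<mu> + A *v z)) (\<bar>det A\<bar> * I)"
    using assms(3) by (rule has_bochner_integral_mult_right)
  then have "has_bochner_integral (distr lborel borel (\<lambda>z. \<mu> + A *v z)) (\<lambda>z. \<bar>det A\<bar> * h z) (\<bar>det A\<bar> * I)"
    using assms(2) by (subst has_bochner_integral_distr) simp_all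
  then show ?thesis
    using assms(2)
    by (subst lborel_matrix_affine[OF assms(1), of \<mu>])
      (auto simp: has_bochner_integral_iff integrable_density integral_density)
qed

section \<open>Moments of the Student kernel\<close>

lemma nn_integral_gaussian_even_moment:
  fixes s :: real
  assumes "s > 0"
  shows "(\<integral>\<^sup>+x. ennreal (x ^ (2 * k) * exp (- s * x\<^sup>2)) \<partial>lborel)
    = ennreal (sqrt (pi / s) * (fact (2 * k) / ((4 * s) ^ k * fact k)))"
proof -
  \<comment> \<open>exp(-s x^2) is sqrt(pi/s) times the normal density of variance 1/(2 s), so that
    2 / \<sigma>^2 = 4 s in the even moments of that density.\<close>
  define \<sigma> where "\<sigma> = 1 / sqrt (2 * s)"
  have \<sigma>: "\<sigma> > 0" "\<sigma>\<^sup>2 = 1 / (2 * s)"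
    using assms by (simp_all add: \<sigma>_def power_divide)
  have eq: "(\<lambda>x. sqrt (pi / s) * (normal_density 0 \<sigma> x * (x - 0) ^ (2 * k))) = (\<lambda>x. x ^ (2 * k) * exp (- s * x\<^sup>2))"
    using assms by (simp add: fun_eq_iff normal_density_def \<sigma>(2) real_sqrt_divide field_simps)
  have "has_bochner_integral lborel (\<lambda>x. sqrt (pi / s) * (normal_density 0 \<sigma> x * (x - 0) ^ (2 * k)))
      (sqrt (pi / s) * (fact (2 * k) / ((2 / \<sigma>\<^sup>2) ^ k * fact k)))"
    by (intro has_bochner_integral_mult_right normal_moment_even \<sigma>(1))
  moreover have "2 / \<sigma>\<^sup>2 = 4 * s" by (simp add: \<sigma>(2))
  ultimately have "has_bochner_integral lborel (\<lambda>x. x ^ (2 * k) * exp (- s * x\<^sup>2))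
      (sqrt (pi / s) * (fact (2 * k) / ((4 * s) ^ k * fact k)))"
    by (simp only: eq)
  then show ?thesis
    by (subst nn_integral_eq_integral) (auto simp: has_bochner_integral_iff)
qed

text \<open>The integrand is a product over coordinates in which only the direction \<open>i\<close>
  carries a monomial, so Tonelli leaves d one-dimensional integrals.\<close>

lemma nn_integral_gaussian_vector_even_moment:
  fixes s :: real and i :: "'a::euclidean_space"
  assumes "s > 0" "i \<in> Basis"
  shows "(\<integral>\<^sup>+z. ennreal ((z \<bullet> i) ^ (2 * k) * exp (- s * (z \<bullet> z))) \<partial>lborel)
    = ennreal ((pi / s) powr (real DIM('a) / 2) * (fact (2 * k) / ((4 * s) ^ k * fact k)))"
proof -
  let ?c = "fact (2 * k) / ((4 * s) ^ k * fact k)"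
  have "(z \<bullet> i) ^ (2 * k) * exp (- s * (z \<bullet> z)) =
      (\<Prod>b\<in>Basis. (z \<bullet> b) ^ (2 * (if b = i then k else 0)) * exp (- s * (z \<bullet> b)\<^sup>2))" for z :: 'a
  proof -
    have "(\<Prod>b\<in>Basis. (z \<bullet> b) ^ (2 * (if b = i then k else 0))) = (\<Prod>b\<in>Basis. if b = i then (z \<bullet> i) ^ (2 * k) else 1)"
      by (rule prod.cong) auto
    moreover have "exp (- s * (z \<bullet> z)) = (\<Prod>b\<in>Basis. exp (- s * (z \<bullet> b)\<^sup>2))"
      by (simp add: exp_sum[symmetric] euclidean_inner[of z z] sum_distrib_left sum_negf power2_eq_square)
    ultimately show ?thesis using assms(2) by (simp add: prod.distrib)
  qed
  then have "(\<integral>\<^sup>+z. ennreal ((z \<bullet> i) ^ (2 * k) * exp (- s * (z \<bullet> z))) \<partial>lborel)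
     = (\<integral>\<^sup>+z. (\<Prod>b\<in>Basis. ennreal ((z \<bullet> b) ^ (2 * (if b = i then k else 0)) * exp (- s * (z \<bullet> b)\<^sup>2))) \<partial>lborel)"
    by (simp add: prod_ennreal)
  also have "\<dots> = (\<Prod>b\<in>(Basis::'a set). \<integral>\<^sup>+x. ennreal (x ^ (2 * (if b = i then k else 0)) * exp (- s * x\<^sup>2)) \<partial>lborel)"
    by (rule nn_integral_lborel_prod[where f = "\<lambda>b x. ennreal (x ^ (2 * (if b = i then k else 0)) * exp (- s * x\<^sup>2))"]) auto
  also have "\<dots> = (\<Prod>b\<in>(Basis::'a set). ennreal (sqrt (pi / s) * (if b = i then ?c else 1)))"
    by (intro prod.cong refl, subst nn_integral_gaussian_even_moment[OF assms(1)]) auto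
  also have "\<dots> = ennreal (\<Prod>b\<in>(Basis::'a set). sqrt (pi / s) * (if b = i then ?c else 1))"
    using assms(1) by (intro prod_ennreal) simp
  also have "(\<Prod>b\<in>(Basis::'a set). sqrt (pi / s) * (if b = i then ?c else 1)) = sqrt (pi / s) ^ DIM('a) * ?c"
    using assms(2) by (simp add: prod.distrib)
  also have "sqrt (pi / s) ^ DIM('a) = (pi / s) powr (real DIM('a) / 2)"
    using assms(1) by (simp add: powr_half_sqrt[symmetric] powr_powr flip: powr_realpow)
  finally show ?thesis .
qed

lemma nn_integral_Gamma_scaled:
  fixes b c :: real
  assumes "b > 0" "c > 0"
  shows "(\<integral>\<^sup>+t. ennreal (indicator {0<..} t * t powr (b - 1) * exp (- (c * t))) \<partial>lborel) = ennreal (Gamma b / c powr b)"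
proof -
  let ?f = "\<lambda>t::real. indicator {0..} t * t powr (b - 1) / exp t"
  have "ennreal (Gamma b / c powr b) = ennreal (1 / c powr b) * ennreal (Gamma b)"
    using assms by (subst ennreal_mult[symmetric]) (auto intro: less_imp_le)
  also have "ennreal (Gamma b) = ennreal c * (\<integral>\<^sup>+t. ennreal (?f (c * t)) \<partial>lborel)"
    using assms by (subst Gamma_conv_nn_integral_real, simp, subst nn_integral_real_affine[of _ c 0]) auto
  also have "ennreal (1 / c powr b) * (ennreal c * (\<integral>\<^sup>+t. ennreal (?f (c * t)) \<partial>lborel))
     = (\<integral>\<^sup>+t. ennreal (c / c powr b) * ennreal (?f (c * t)) \<partial>lborel)"
    using assms by (subst nn_integral_cmult) (auto simp: ennreal_mult[symmetric] mult.assoc[symmetric])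
  also have "\<dots> = (\<integral>\<^sup>+t. ennreal (indicator {0<..} t * t powr (b - 1) * exp (- (c * t))) \<partial>lborel)"
  proof (intro nn_integral_cong)
    fix t :: real
    have "c / c powr b * ?f (c * t) = indicator {0<..} t * t powr (b - 1) * exp (- (c * t))"
    proof (cases "t > 0")
      case True
      then have "?f (c * t) = (c powr b / c) * (t powr (b - 1) * exp (- (c * t)))"
        using assms by (simp add: powr_mult powr_diff exp_minus field_simps)
      then show ?thesis using assms True by simp
    next
      case False
      \<comment> \<open>The two indicators differ only at t = 0, where \<open>0 powr (b - 1)\<close>
        is 0 by convention.\<close>
      then show ?thesis using assms by (cases "t = 0") (auto simp: indicator_def zero_le_mult_iff)
    qed
    then show "ennreal (c / c powr b) * ennreal (?f (c * t)) = ennreal (indicator {0<..} t * t powr (b - 1) * exp (- (c * t)))"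
      using assms by (subst ennreal_mult[symmetric]) auto
  qed
  finally show ?thesis ..
qed

text \<open>
  The kernel is a Gamma mixture of Gaussians:
  \<open>\<Gamma>(b) (1 + |z|\<^sup>2)\<^sup>-\<^sup>b\<close> is the integral of \<open>t\<^sup>b\<^sup>-\<^sup>1 exp (-t) exp (-t |z|\<^sup>2)\<close> over \<open>t > 0\<close>.
\<close>

lemma nn_integral_student_even_moment:
  fixes i :: "'a::euclidean_space" and b :: real
  assumes i: "i \<in> Basis" and b: "b > real DIM('a) / 2 + real k"
  shows "(\<integral>\<^sup>+z. ennreal ((z \<bullet> i) ^ (2 * k) * (1 + z \<bullet> z) powr (- b)) \<partial>lborel)
    = ennreal (pi powr (real DIM('a) / 2) * (fact (2 * k) / (4 ^ k * fact k))
        * Gamma (b - real DIM('a) / 2 - real k) / Gamma b)"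
proof -
  let ?d = "real DIM('a) / 2"
  let ?c = "pi powr ?d * (fact (2 * k) / (4 ^ k * fact k))"
  have b0: "b > 0" using b by (smt (verit) of_nat_0_le_iff divide_nonneg_nonneg)
  let ?g = "\<lambda>(t::real) (z::'a). (z \<bullet> i) ^ (2 * k) * (indicator {0<..} t * t powr (b - 1) * exp (- ((1 + z \<bullet> z) * t)))"
  have pos: "1 + z \<bullet> z > 0" for z :: 'a by (smt (verit) inner_ge_zero)
  have "(\<integral>\<^sup>+z. ennreal ((z \<bullet> i) ^ (2 * k) * (1 + z \<bullet> z) powr (- b)) \<partial>lborel)
      = (\<integral>\<^sup>+z. ennreal (1 / Gamma b) * (\<integral>\<^sup>+t. ennreal (?g t z) \<partial>lborel) \<partial>lborel)"
  proof (intro nn_integral_cong)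
    fix z :: 'a
    have "(\<integral>\<^sup>+t. ennreal (?g t z) \<partial>lborel) = (\<integral>\<^sup>+t. ennreal ((z \<bullet> i) ^ (2 * k)) *
        ennreal (indicator {0<..} t * t powr (b - 1) * exp (- ((1 + z \<bullet> z) * t))) \<partial>lborel)"
      by (intro nn_integral_cong ennreal_mult) auto
    also have "\<dots> = ennreal ((z \<bullet> i) ^ (2 * k)) * ennreal (Gamma b / (1 + z \<bullet> z) powr b)"
      by (subst nn_integral_cmult) (simp_all add: nn_integral_Gamma_scaled[OF b0 pos])
    finally have I: "(\<integral>\<^sup>+t. ennreal (?g t z) \<partial>lborel) = \<dots>" .
    show "ennreal ((z \<bullet> i) ^ (2 * k) * (1 + z \<bullet> z) powr (- b)) = ennreal (1 / Gamma b) * (\<integral>\<^sup>+t. ennreal (?g t z) \<partial>lborel)"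
      unfolding I using Gamma_real_pos[OF b0]
      by (simp add: ennreal_mult[symmetric] powr_minus_divide)
  qed
  also have "\<dots> = ennreal (1 / Gamma b) * (\<integral>\<^sup>+z. (\<integral>\<^sup>+t. ennreal (?g t z) \<partial>lborel) \<partial>lborel)"
    by (rule nn_integral_cmult) measurable
  also have "(\<integral>\<^sup>+z. (\<integral>\<^sup>+t. ennreal (?g t z) \<partial>lborel) \<partial>lborel) = (\<integral>\<^sup>+t. (\<integral>\<^sup>+z. ennreal (?g t z) \<partial>lborel) \<partial>lborel)"
    by (rule lborel_pair.Fubini') measurable
  also have "\<dots> = (\<integral>\<^sup>+t. ennreal ?c * ennreal (indicator {0<..} t * t powr (b - ?d - real k - 1) * exp (- (1 * t))) \<partial>lborel)"
  proof (intro nn_integral_cong)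
    fix t :: real
    show "(\<integral>\<^sup>+z. ennreal (?g t z) \<partial>lborel) =
        ennreal ?c * ennreal (indicator {0<..} t * t powr (b - ?d - real k - 1) * exp (- (1 * t)))"
    proof (cases "t > 0")
      case True
      have "(\<integral>\<^sup>+z. ennreal (?g t z) \<partial>lborel)
          = (\<integral>\<^sup>+z. ennreal (t powr (b - 1) * exp (- t)) * ennreal ((z \<bullet> i) ^ (2 * k) * exp (- t * (z \<bullet> z))) \<partial>lborel)"
      proof (intro nn_integral_cong)
        fix z :: 'a
        have "exp (- ((1 + z \<bullet> z) * t)) = exp (- t) * exp (- t * (z \<bullet> z))"
          by (simp add: exp_add[symmetric] algebra_simps)
        then show "ennreal (?g t z) = ennreal (t powr (b - 1) * exp (- t)) * ennreal ((z \<bullet> i) ^ (2 * k) * exp (- t * (z \<bullet> z)))"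
          using True by (subst ennreal_mult[symmetric]) (simp_all add: mult_ac zero_le_even_power)
      qed
      also have "\<dots> = ennreal (t powr (b - 1) * exp (- t)) * ennreal ((pi / t) powr ?d * (fact (2 * k) / ((4 * t) ^ k * fact k)))"
        by (subst nn_integral_cmult) (simp_all only: nn_integral_gaussian_vector_even_moment[OF True i], measurable)
      also have "\<dots> = ennreal ((t powr (b - 1) * exp (- t)) * ((pi / t) powr ?d * (fact (2 * k) / ((4 * t) ^ k * fact k))))"
        using True by (subst ennreal_mult) auto
      also have "(t powr (b - 1) * exp (- t)) * ((pi / t) powr ?d * (fact (2 * k) / ((4 * t) ^ k * fact k)))
          = ?c * (t powr (b - ?d - real k - 1) * exp (- t))"
      proof -
        \<comment> \<open>The Gaussian moment contributes t^(-d/2 - k), so what remains is a Gamma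
          integral with parameter b - d/2 - k, positive by assumption.\<close>
        have "t powr (b - 1) = t powr ?d * t ^ k * t powr (b - ?d - real k - 1)"
          using True by (simp add: powr_realpow[symmetric] powr_add[symmetric])
        then show ?thesis using True by (simp add: powr_divide power_mult_distrib)
      qed
      also have "ennreal \<dots> = ennreal ?c * ennreal (t powr (b - ?d - real k - 1) * exp (- t))"
        by (rule ennreal_mult) auto
      finally show ?thesis using True by simp
    qed simp
  qed
  also have "\<dots> = ennreal ?c * ennreal (Gamma (b - ?d - real k))"
    using nn_integral_Gamma_scaled[of "b - ?d - real k" 1] b by (subst nn_integral_cmult) auto
  finally show ?thesis
    using b Gamma_real_pos[OF b0] Gamma_real_pos[of "b - ?d - real k"]
    by (simp add: ennreal_mult[symmetric] mult_ac)
qed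

section \<open>The standard kernel and its moments up to order two\<close>

text \<open>The integral of \<open>std_kernel\<close> over d-dimensional space: the case k = 0 of
  the moment formula with b = (\<nu> + d)/2, where b - d/2 = \<nu>/2.\<close>

definition student_mass :: "real \<Rightarrow> nat \<Rightarrow> real" where
  "student_mass \<nu> d = pi powr (real d / 2) * Gamma (\<nu> / 2) / Gamma ((\<nu> + real d) / 2)"

lemma student_mass_pos: "\<nu> > 0 \<Longrightarrow> student_mass \<nu> d > 0"
  by (simp add: student_mass_def Gamma_real_pos add_pos_nonneg)

text \<open>This is the Student kernel with location 0 and scale matrix 1/\<nu> times the identity,
  so that \<nu> drops out of the quadratic form.\<close>

abbreviation std_kernel :: "real \<Rightarrow> real ^ 'n \<Rightarrow> real" where
  "std_kernel \<nu> z \<equiv> (1 + z \<bullet> z) powr (- ((\<nu> + real CARD('n)) / 2))"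

lemma has_bochner_integral_std_kernel:
  assumes "\<nu> > 0"
  shows "has_bochner_integral lborel (\<lambda>z :: real ^ 'n. std_kernel \<nu> z) (student_mass \<nu> CARD('n))"
proof -
  obtain i :: "real ^ 'n" where i: "i \<in> Basis" using nonempty_Basis by blast
  have "(\<nu> + real CARD('n)) / 2 - real DIM(real ^ 'n) / 2 - real 0 = \<nu> / 2"
    by (simp add: field_simps)
  then show ?thesis
    using assms nn_integral_student_even_moment[OF i, of 0 "(\<nu> + real CARD('n)) / 2"]
      student_mass_pos[OF assms, of "CARD('n)"]
    by (intro has_bochner_integral_nn_integral) (auto simp: student_mass_def field_simps)
qed

text \<open>The case k = 1 of the moment formula. Here b > d/2 + 1 means \<nu> > 2, and the
  functional equation of Gamma at \<nu>/2 - 1 yields 2/(\<nu> - 2), which the factor 2!/4 = 1/2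
  turns into 1/(\<nu> - 2).\<close>

lemma has_bochner_integral_std_kernel_square:
  assumes "\<nu> > 2"
  shows "has_bochner_integral lborel (\<lambda>z :: real ^ 'n. (z $ i)\<^sup>2 * std_kernel \<nu> z) (student_mass \<nu> CARD('n) / (\<nu> - 2))"
proof -
  let ?b = "(\<nu> + real CARD('n)) / 2"
  have i: "axis i 1 \<in> (Basis :: (real ^ 'n) set)" by simp
  have e: "?b - real CARD('n) / 2 - real 1 = \<nu> / 2 - 1"
    by (simp add: field_simps)
  have "Gamma (\<nu> / 2) = (\<nu> / 2 - 1) * Gamma (\<nu> / 2 - 1)"
    using Gamma_plus1[of "\<nu> / 2 - 1"] assms nonpos_Ints_nonpos[of "\<nu> / 2 - 1"] by force
  then have "Gamma (\<nu> / 2 - 1) = 2 * Gamma (\<nu> / 2) / (\<nu> - 2)"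
    using assms by (simp only:) (simp add: divide_simps)
  then have "pi powr (real CARD('n) / 2) * (1 / 2) * Gamma (\<nu> / 2 - 1) / Gamma ?b = student_mass \<nu> CARD('n) / (\<nu> - 2)"
    by (simp add: student_mass_def)
  moreover have "(fact (2 * 1) / (4 ^ 1 * fact 1) :: real) = 1 / 2" by (simp add: fact_2)
  moreover have "?b > real DIM(real ^ 'n) / 2 + real 1"
    using assms by (simp add: field_simps)
  ultimately have "(\<integral>\<^sup>+z. ennreal ((z \<bullet> axis i 1) ^ (2 * 1) * std_kernel \<nu> z) \<partial>lborel) = ennreal (student_mass \<nu> CARD('n) / (\<nu> - 2))"
    using nn_integral_student_even_moment[OF i, of 1 ?b]
    by (simp only: DIM_cart DIM_real mult_1_right e)
  then have "(\<integral>\<^sup>+z. ennreal ((z $ i)\<^sup>2 * std_kernel \<nu> z) \<partial>lborel) = ennreal (student_mass \<nu> CARD('n) / (\<nu> - 2))"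
    by (simp add: inner_axis)
  then show ?thesis
    using assms student_mass_pos[of \<nu> "CARD('n)"]
    by (intro has_bochner_integral_nn_integral) auto
qed

text \<open>Substituting \<open>A *v z\<close> has Jacobian 1 and changes the sign of the integrand,
  so the integral equals its own negative.\<close>

lemma odd_integral_zero:
  fixes A :: "real ^ 'n ^ 'n" and g :: "real ^ 'n \<Rightarrow> real"
  assumes "\<bar>det A\<bar> = 1" "\<And>z. g (A *v z) = - g z" "integrable lborel g"
  shows "has_bochner_integral lborel g 0"
proof -
  have "has_bochner_integral lborel (\<lambda>z. g (0 + A *v z)) (- integral\<^sup>L lborel g)"
    using assms(3) by (simp add: assms(2) has_bochner_integral_iff)
  then have "has_bochner_integral lborel g (\<bar>det A\<bar> * (- integral\<^sup>L lborel g))"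
    using assms(1,3) by (intro has_bochner_integral_lborel_matrix_affine[where \<mu> = 0]) auto
  then have "integral\<^sup>L lborel g = - integral\<^sup>L lborel g"
    using assms(1) by (simp add: has_bochner_integral_iff)
  then show ?thesis using assms(3) by (simp add: has_bochner_integral_iff)
qed

text \<open>Changing the sign of one coordinate preserves \<open>z \<bullet> z\<close>, and so the
  kernel, while it negates \<open>z $ i\<close> and, for distinct indices,
  \<open>z $ i * z $ j\<close>.\<close>

definition reflection :: "'n \<Rightarrow> real ^ 'n ^ 'n" where
  "reflection i = (\<chi> k l. if k = l then if k = i then - 1 else 1 else 0)"

lemma abs_det_reflection: "\<bar>det (reflection i)\<bar> = 1"
  by (subst det_diagonal) (auto simp: reflection_def abs_prod)

lemma reflection_component: "(reflection i *v z) $ k = (if k = i then - z $ k else z $ k)"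
proof -
  have "(reflection i *v z) $ k = (\<Sum>l\<in>UNIV. if l = k then if k = i then - z $ k else z $ k else 0)"
    unfolding matrix_vector_mult_def vec_lambda_beta
    by (intro sum.cong) (auto simp: reflection_def)
  then show ?thesis by simp
qed

lemma reflection_inner: "(reflection i *v z) \<bullet> (reflection i *v z) = z \<bullet> z"
  unfolding inner_vec_def by (intro sum.cong) (simp_all add: reflection_component)

text \<open>Reflections give the vanishing moments once integrability is known. The latter follows
  by domination: |x| is at most 1 + x^2, and |x y| at most x^2 + y^2.\<close>

lemma has_bochner_integral_std_kernel_moments:
  fixes i j :: "'n::finite"
  assumes \<nu>: "\<nu> > 2"
  shows has_bochner_integral_std_kernel_linear:
      "has_bochner_integral lborel (\<lambda>z :: real ^ 'n. z $ i * std_kernel \<nu> z) 0"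
    and has_bochner_integral_std_kernel_product:
      "has_bochner_integral lborel (\<lambda>z :: real ^ 'n. z $ i * z $ j * std_kernel \<nu> z)
        (if i = j then student_mass \<nu> CARD('n) / (\<nu> - 2) else 0)"
proof -
  have sq: "integrable lborel (\<lambda>z :: real ^ 'n. (z $ i)\<^sup>2 * std_kernel \<nu> z)" for i :: 'n
    using has_bochner_integral_std_kernel_square[OF \<nu>, of i] by (simp add: has_bochner_integral_iff)
  have one: "integrable lborel (\<lambda>z :: real ^ 'n. std_kernel \<nu> z)"
    using has_bochner_integral_std_kernel[of \<nu>] \<nu> by (auto simp: has_bochner_integral_iff)
  have amgm: "\<bar>x * y\<bar> \<le> x\<^sup>2 + y\<^sup>2" for x y :: real
  proof -
    have "2 * \<bar>x * y\<bar> \<le> x\<^sup>2 + y\<^sup>2"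
      using sum_squares_bound[of "\<bar>x\<bar>" "\<bar>y\<bar>"] by (simp add: abs_mult)
    then show ?thesis using abs_ge_zero[of "x * y"] by linarith
  qed
  have "integrable lborel (\<lambda>z :: real ^ 'n. z $ i * std_kernel \<nu> z)"
  proof (rule Bochner_Integration.integrable_bound[OF Bochner_Integration.integrable_add[OF one sq[of i]]])
    show "AE z :: real ^ 'n in lborel. norm (z $ i * std_kernel \<nu> z) \<le> norm (std_kernel \<nu> z + (z $ i)\<^sup>2 * std_kernel \<nu> z)"
    proof (intro AE_I2)
      fix z :: "real ^ 'n"
      have "\<bar>z $ i\<bar> * std_kernel \<nu> z \<le> (1 + (z $ i)\<^sup>2) * std_kernel \<nu> z"
        using amgm[of 1 "z $ i"] by (intro mult_right_mono) auto
      then show "norm (z $ i * std_kernel \<nu> z) \<le> norm (std_kernel \<nu> z + (z $ i)\<^sup>2 * std_kernel \<nu> z)"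
        by (simp add: abs_mult distrib_right)
    qed
  qed measurable
  then show "has_bochner_integral lborel (\<lambda>z :: real ^ 'n. z $ i * std_kernel \<nu> z) 0"
    by (intro odd_integral_zero[OF abs_det_reflection[of i]])
      (simp_all add: reflection_component reflection_inner)
  have prod: "integrable lborel (\<lambda>z :: real ^ 'n. z $ i * z $ j * std_kernel \<nu> z)"
  proof (rule Bochner_Integration.integrable_bound[OF Bochner_Integration.integrable_add[OF sq[of i] sq[of j]]])
    show "AE z :: real ^ 'n in lborel. norm (z $ i * z $ j * std_kernel \<nu> z) \<le> norm ((z $ i)\<^sup>2 * std_kernel \<nu> z + (z $ j)\<^sup>2 * std_kernel \<nu> z)"
    proof (intro AE_I2)
      fix z :: "real ^ 'n"
      have "\<bar>z $ i * z $ j\<bar> * std_kernel \<nu> z \<le> ((z $ i)\<^sup>2 + (z $ j)\<^sup>2) * std_kernel \<nu> z"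
        using amgm by (intro mult_right_mono) auto
      then show "norm (z $ i * z $ j * std_kernel \<nu> z) \<le> norm ((z $ i)\<^sup>2 * std_kernel \<nu> z + (z $ j)\<^sup>2 * std_kernel \<nu> z)"
        by (simp add: abs_mult distrib_right)
    qed
  qed measurable
  show "has_bochner_integral lborel (\<lambda>z :: real ^ 'n. z $ i * z $ j * std_kernel \<nu> z)
        (if i = j then student_mass \<nu> CARD('n) / (\<nu> - 2) else 0)"
  proof (cases "i = j")
    case True
    then show ?thesis
      using has_bochner_integral_std_kernel_square[OF \<nu>, of j] by (simp add: power2_eq_square)
  next
    case False
    then show ?thesis
      using odd_integral_zero[OF abs_det_reflection[of i] _ prod]
      by (simp add: reflection_component reflection_inner)
  qed
qed

text \<open>The integral of the kernel with unit scale matrix, that is, \<nu>^(d/2) times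
  \<open>student_mass\<close>. The power stays a determinant to match the Jacobian of the
  substitution. Being independent of the parameter, this factor contributes nothing to the
  score.\<close>

definition student_volume :: "real \<Rightarrow> 'n::finite itself \<Rightarrow> real" where
  "student_volume \<nu> (_ :: 'n itself) = \<bar>det (sqrt \<nu> *\<^sub>R mat 1 :: real ^ 'n ^ 'n)\<bar> * student_mass \<nu> CARD('n)"

lemma student_volume_pos: "\<nu> > 0 \<Longrightarrow> student_volume \<nu> TYPE('n::finite) > 0"
  by (simp add: student_volume_def student_mass_pos det_diagonal mat_def)

section \<open>Score and estimating equations\<close>

text \<open>Together with \<open>scale_direction\<close> this is the velocity of the parameter when
  one coordinate varies. Location and scale coordinates can then be treated by a single line (\<mu>
  + h v, \<Sigma> + h E).\<close>

fun loc_direction :: "'n::finite coord \<Rightarrow> real ^ 'n" where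
  "loc_direction (Loc i) = axis i 1"
| "loc_direction (Scale i j) = 0"

fun scale_direction :: "'n::finite coord \<Rightarrow> real ^ 'n ^ 'n" where
  "scale_direction (Loc i) = 0"
| "scale_direction (Scale i j) = (\<chi> k l. if (k = i \<and> l = j) \<or> (k = j \<and> l = i) then 1 else 0)"

lemma transpose_scale_direction: "transpose (scale_direction c) = scale_direction c"
  by (cases c) (auto simp: transpose_def vec_eq_iff)

text \<open>\<open>set_coord\<close> writes one value into the entries (i, j) and (j, i). This is a
  shift of both by h only because they agreed beforehand, hence the symmetry assumption.\<close>

lemma set_coord_eq_line:
  assumes "transpose (snd \<theta>) = snd \<theta>"
  shows "set_coord \<theta> c (get_coord \<theta> c + h) = (fst \<theta> + h *\<^sub>R loc_direction c, snd \<theta> + h *\<^sub>R scale_direction c)"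
  using symmetric_component[OF assms] by (cases c) (auto simp: vec_eq_iff axis_def)

lemma trace_scale_direction:
  fixes X :: "real ^ 'n ^ 'n"
  assumes "transpose X = X"
  shows "trace (scale_direction (Scale i j) ** X) = (if i = j then 1 else 2) * X $ i $ j"
proof -
  have "trace (scale_direction (Scale i j) ** X) = (\<Sum>k\<in>UNIV. \<Sum>l\<in>UNIV.
      (if l = j then if k = i then X $ j $ i else 0 else 0)
      + (if i = j then 0 else if l = i then if k = j then X $ i $ j else 0 else 0))"
    unfolding trace_def matrix_matrix_mult_def vec_lambda_beta
    by (intro sum.cong refl) auto
  also have "\<dots> = (if i = j then 1 else 2) * X $ i $ j"
    using symmetric_component[OF assms, of i j] by (simp add: sum.distrib)
  finally show ?thesis .
qed

text \<open>The scale directions span the symmetric matrices, on which the trace pairing is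
  nondegenerate. This merges the scalar equations of the scale coordinates into one matrix
  equation.\<close>

lemma symmetric_eq_0_if_trace:
  fixes X :: "real ^ 'n ^ 'n"
  assumes sym: "transpose X = X" and tr: "\<And>i j. trace (scale_direction (Scale i j) ** X) = 0"
  shows "X = 0"
proof -
  have "X $ i $ j = 0" for i j
    using tr[of i j] trace_scale_direction[OF sym, of i j] by (auto split: if_splits)
  then show ?thesis by (simp add: vec_eq_iff)
qed

lemma scale_direction_commute: "scale_direction (Scale j i) = scale_direction (Scale i j)"
  by (auto simp: vec_eq_iff)

text \<open>Deviations are taken from a candidate \<open>\<mu>\<close>, as in
  \<open>second_moment\<close> below; the sample mean enters only once the location equations are
  solved.\<close>

definition mean_deviation :: "nat \<Rightarrow> (nat \<Rightarrow> real ^ 'n) \<Rightarrow> real ^ 'n \<Rightarrow> real ^ 'n" where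
  "mean_deviation n x \<mu> = (1 / real n) *\<^sub>R (\<Sum>r = 1..n. x r - \<mu>)"

definition second_moment :: "nat \<Rightarrow> (nat \<Rightarrow> real ^ 'n) \<Rightarrow> real ^ 'n \<Rightarrow> real ^ 'n ^ 'n" where
  "second_moment n x \<mu> = (\<chi> i j. (1 / real n) * (\<Sum>r = 1..n. (x r - \<mu>) $ i * (x r - \<mu>) $ j))"

lemma transpose_second_moment: "transpose (second_moment n x \<mu>) = second_moment n x \<mu>"
  by (simp add: transpose_def second_moment_def mult.commute)

lemma average_inner:
  "(1 / real n) * (\<Sum>r = 1..n. v \<bullet> (x r - \<mu>)) = v \<bullet> mean_deviation n x \<mu>"
  by (simp add: mean_deviation_def inner_sum_right)

lemma average_quadratic:
  fixes M :: "real ^ 'n ^ 'n"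
  shows "(1 / real n) * (\<Sum>r = 1..n. (x r - \<mu>) \<bullet> (M *v (x r - \<mu>))) = trace (M ** second_moment n x \<mu>)"
proof -
  let ?y = "\<lambda>r. x r - \<mu>"
  have "trace (M ** second_moment n x \<mu>)
      = (\<Sum>i\<in>UNIV. \<Sum>j\<in>UNIV. \<Sum>r = 1..n. 1 / real n * (?y r $ i * (M $ i $ j * ?y r $ j)))"
    unfolding trace_def matrix_matrix_mult_def second_moment_def vec_lambda_beta
    unfolding sum_distrib_left by (intro sum.cong refl) simp
  also have "\<dots> = (\<Sum>i\<in>UNIV. \<Sum>r = 1..n. \<Sum>j\<in>UNIV. 1 / real n * (?y r $ i * (M $ i $ j * ?y r $ j)))"
    by (intro sum.cong refl sum.swap)
  also have "\<dots> = (\<Sum>r = 1..n. \<Sum>i\<in>UNIV. \<Sum>j\<in>UNIV. 1 / real n * (?y r $ i * (M $ i $ j * ?y r $ j)))"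
    by (rule sum.swap)
  also have "\<dots> = (1 / real n) * (\<Sum>r = 1..n. ?y r \<bullet> (M *v ?y r))"
    unfolding inner_vec_def matrix_vector_mult_def vec_lambda_beta
    by (simp add: sum_distrib_left)
  finally show ?thesis ..
qed

section \<open>Moments of the Student density\<close>

text \<open>A point of the parameter space, with \<nu> tied to \<alpha>. The locale is also
  interpreted at nearby points of a line through \<open>\<theta>\<close>, where the formula for the
  log density is needed to differentiate it.\<close>

locale student =
  fixes \<alpha> \<nu> :: real and \<theta> :: "'n::finite student_param"
  assumes nu: "\<nu> > 2" "\<alpha> = 1 - 2 / (\<nu> + real CARD('n))"
    and scale: "pos_def (snd \<theta>)"
begin

lemma exponent: "1 / (\<alpha> - 1) = - ((\<nu> + real CARD('n)) / 2)"
proof -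
  have "\<alpha> - 1 = - (2 / (\<nu> + real CARD('n)))" using nu by simp
  then show ?thesis by simp
qed

lemma quadratic_nonneg: "x \<bullet> (matrix_inv (snd \<theta>) *v x) \<ge> 0"
  using pos_def_inv[OF scale] by (cases "x = 0") (auto simp: pos_def_def intro: less_imp_le)

lemma kernel_base_pos: "1 + 1 / \<nu> * (x \<bullet> (matrix_inv (snd \<theta>) *v x)) > 0"
  using quadratic_nonneg[of x] nu by (intro add_pos_nonneg) auto

lemma kernel_measurable [measurable]: "student_kernel \<alpha> \<nu> \<theta> \<in> borel_measurable borel"
  unfolding student_kernel_def by measurable

text \<open>The matrix is sqrt(\<nu>) B with B B^T equal to the scale matrix; the factor sqrt(\<nu>)
  cancels the 1/\<nu> in the kernel. Since |det B| is the root of det \<Sigma>, the Jacobian splits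
  into a constant and this root.\<close>

lemma standardization:
  obtains A :: "real ^ 'n ^ 'n" where "det A \<noteq> 0" "A ** transpose A = \<nu> *\<^sub>R snd \<theta>"
    "\<And>z. student_kernel \<alpha> \<nu> \<theta> (fst \<theta> + A *v z) = std_kernel \<nu> z"
    "\<bar>det A\<bar> * student_mass \<nu> CARD('n) = student_volume \<nu> TYPE('n) * sqrt (det (snd \<theta>))"
proof -
  obtain B :: "real ^ 'n ^ 'n" where B: "transpose B ** matrix_inv (snd \<theta>) ** B = mat 1"
      "B ** transpose B = snd \<theta>" "det (snd \<theta>) = (det B)\<^sup>2" "det B \<noteq> 0"
    using pos_def_factor[OF scale] .
  define D :: "real ^ 'n ^ 'n" where "D = sqrt \<nu> *\<^sub>R mat 1"
  define A where "A = sqrt \<nu> *\<^sub>R B"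
  have AD: "A = D ** B" by (simp add: A_def D_def scalar_matrix_assoc[symmetric])
  have "det D \<noteq> 0" using nu by (simp add: D_def det_diagonal mat_def)
  with B(4) have d: "det A \<noteq> 0" by (simp add: AD det_mul)
  have "transpose A = sqrt \<nu> *\<^sub>R transpose B" by (simp add: A_def transpose_def vec_eq_iff)
  then have AA: "A ** transpose A = \<nu> *\<^sub>R snd \<theta>"
    using nu by (simp add: A_def scalar_matrix_assoc[symmetric] matrix_mult_scaleR B(2))
  have k: "student_kernel \<alpha> \<nu> \<theta> (fst \<theta> + A *v z) = std_kernel \<nu> z" for z
  proof -
    have "(B *v z) \<bullet> (matrix_inv (snd \<theta>) *v (B *v z)) = z \<bullet> ((transpose B ** matrix_inv (snd \<theta>) ** B) *v z)"
      using matrix_vector_mult_inner_transpose[of z "transpose B" "matrix_inv (snd \<theta>) *v (B *v z)"]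
      by (simp add: matrix_vector_mul_assoc[symmetric])
    then have "(A *v z) \<bullet> (matrix_inv (snd \<theta>) *v (A *v z)) = sqrt \<nu> * sqrt \<nu> * (z \<bullet> z)"
      by (simp only: A_def B(1) scaleR_matrix_vector_assoc[symmetric] matrix_vector_mult_scaleR inner_scaleR_left
          inner_scaleR_right matrix_vector_mul_lid mult.assoc)
    also have "\<dots> = \<nu> * (z \<bullet> z)" using nu by simp
    finally have "1 / \<nu> * ((A *v z) \<bullet> (matrix_inv (snd \<theta>) *v (A *v z))) = z \<bullet> z" using nu by simp
    then show ?thesis by (simp only: student_kernel_def exponent add_diff_cancel_left')
  qed
  have "\<bar>det A\<bar> * student_mass \<nu> CARD('n) = student_volume \<nu> TYPE('n) * sqrt (det (snd \<theta>))"
    by (simp add: AD det_mul abs_mult student_volume_def D_def B(3))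
  from that[OF d AA k this] show ?thesis .
qed

definition mass :: real where
  "mass = student_volume \<nu> TYPE('n) * sqrt (det (snd \<theta>))"

lemma mass_pos: "mass > 0"
  using nu student_volume_pos[of \<nu>, where 'n = 'n] pos_def_det_pos[OF scale] by (simp add: mass_def)

lemma has_bochner_integral_kernel: "has_bochner_integral lborel (student_kernel \<alpha> \<nu> \<theta>) mass"
proof -
  obtain A :: "real ^ 'n ^ 'n" where A: "det A \<noteq> 0" "A ** transpose A = \<nu> *\<^sub>R snd \<theta>"
    "\<And>z. student_kernel \<alpha> \<nu> \<theta> (fst \<theta> + A *v z) = std_kernel \<nu> z"
    "\<bar>det A\<bar> * student_mass \<nu> CARD('n) = student_volume \<nu> TYPE('n) * sqrt (det (snd \<theta>))"
    using standardization by blast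
  have "has_bochner_integral lborel (\<lambda>z. student_kernel \<alpha> \<nu> \<theta> (fst \<theta> + A *v z)) (student_mass \<nu> CARD('n))"
    unfolding A(3) using nu by (intro has_bochner_integral_std_kernel) simp
  from has_bochner_integral_lborel_matrix_affine[OF A(1) kernel_measurable this]
  show ?thesis by (simp only: A(4) mass_def)
qed

lemma has_bochner_integral_kernel_linear:
  "has_bochner_integral lborel (\<lambda>y. student_kernel \<alpha> \<nu> \<theta> y * (y - fst \<theta>) $ i) 0"
proof -
  obtain A :: "real ^ 'n ^ 'n" where A: "det A \<noteq> 0" "A ** transpose A = \<nu> *\<^sub>R snd \<theta>"
    "\<And>z. student_kernel \<alpha> \<nu> \<theta> (fst \<theta> + A *v z) = std_kernel \<nu> z"
    "\<bar>det A\<bar> * student_mass \<nu> CARD('n) = student_volume \<nu> TYPE('n) * sqrt (det (snd \<theta>))"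
    using standardization by blast
  have eq: "std_kernel \<nu> z * (A *v z) $ i = (\<Sum>k\<in>UNIV. A $ i $ k * (z $ k * std_kernel \<nu> z))" for z
    unfolding matrix_vector_mult_def vec_lambda_beta sum_distrib_left by (intro sum.cong) simp_all
  have "has_bochner_integral lborel (\<lambda>z. \<Sum>k\<in>UNIV. A $ i $ k * (z $ k * std_kernel \<nu> z)) (\<Sum>k\<in>UNIV. A $ i $ k * 0)"
    by (intro has_bochner_integral_sum has_bochner_integral_mult_right has_bochner_integral_std_kernel_linear nu)
  then have "has_bochner_integral lborel (\<lambda>z. std_kernel \<nu> z * (A *v z) $ i) 0"
    by (simp only: eq) simp
  then show ?thesis
    using has_bochner_integral_lborel_matrix_affine[OF A(1),
        of "\<lambda>y. student_kernel \<alpha> \<nu> \<theta> y * (y - fst \<theta>) $ i" "fst \<theta>" 0]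
    by (simp add: A(3))
qed

text \<open>Standardized second moments are 1/(\<nu> - 2) times the identity, relative to the mass.
  Conjugation by \<open>A\<close> turns this into A A^T/(\<nu> - 2), which is K.\<close>

lemma has_bochner_integral_kernel_product:
  "has_bochner_integral lborel (\<lambda>y. student_kernel \<alpha> \<nu> \<theta> y * ((y - fst \<theta>) $ i * (y - fst \<theta>) $ j))
     (mass * (\<nu> / (\<nu> - 2) * snd \<theta> $ i $ j))"
proof -
  obtain A :: "real ^ 'n ^ 'n" where A: "det A \<noteq> 0" "A ** transpose A = \<nu> *\<^sub>R snd \<theta>"
    "\<And>z. student_kernel \<alpha> \<nu> \<theta> (fst \<theta> + A *v z) = std_kernel \<nu> z"
    "\<bar>det A\<bar> * student_mass \<nu> CARD('n) = student_volume \<nu> TYPE('n) * sqrt (det (snd \<theta>))"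
    using standardization by blast
  let ?m = "student_mass \<nu> CARD('n) / (\<nu> - 2)"
  have eq: "std_kernel \<nu> z * ((A *v z) $ i * (A *v z) $ j) =
      (\<Sum>k\<in>UNIV. \<Sum>l\<in>UNIV. A $ i $ k * A $ j $ l * (z $ k * z $ l * std_kernel \<nu> z))" for z
    unfolding matrix_vector_mult_def vec_lambda_beta sum_product
    unfolding sum_distrib_left by (intro sum.cong) simp_all
  have "\<nu> * snd \<theta> $ i $ j = (A ** transpose A) $ i $ j" by (simp add: A(2))
  also have "\<dots> = (\<Sum>k\<in>UNIV. A $ i $ k * A $ j $ k)"
    by (simp add: matrix_matrix_mult_def transpose_def)
  finally have "(\<Sum>k\<in>UNIV. \<Sum>l\<in>UNIV. A $ i $ k * A $ j $ l * (if k = l then ?m else 0)) = \<nu> * snd \<theta> $ i $ j * ?m"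
    by (simp add: if_distrib sum_distrib_right sum_divide_distrib cong: if_cong)
  moreover have "has_bochner_integral lborel (\<lambda>z. std_kernel \<nu> z * ((A *v z) $ i * (A *v z) $ j))
      (\<Sum>k\<in>UNIV. \<Sum>l\<in>UNIV. A $ i $ k * A $ j $ l * (if k = l then ?m else 0))"
    unfolding eq
    by (intro has_bochner_integral_sum has_bochner_integral_mult_right has_bochner_integral_std_kernel_product nu)
  ultimately have "has_bochner_integral lborel (\<lambda>z. std_kernel \<nu> z * ((A *v z) $ i * (A *v z) $ j))
      (\<nu> * snd \<theta> $ i $ j * ?m)" by simp
  then have "has_bochner_integral lborel (\<lambda>y. student_kernel \<alpha> \<nu> \<theta> y * ((y - fst \<theta>) $ i * (y - fst \<theta>) $ j))
      (\<bar>det A\<bar> * (\<nu> * snd \<theta> $ i $ j * ?m))"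
    by (intro has_bochner_integral_lborel_matrix_affine[OF A(1), of _ "fst \<theta>"]) (simp_all add: A(3))
  also have "\<bar>det A\<bar> * (\<nu> * snd \<theta> $ i $ j * ?m) = (\<bar>det A\<bar> * student_mass \<nu> CARD('n)) * (\<nu> / (\<nu> - 2) * snd \<theta> $ i $ j)"
    by simp
  finally show ?thesis by (simp only: A(4) mass_def)
qed

lemma student_density_eq: "student_density \<alpha> \<nu> \<theta> y = student_kernel \<alpha> \<nu> \<theta> y / mass"
  using has_bochner_integral_kernel
  by (simp add: student_density_def student_const_def has_bochner_integral_iff)

lemma student_density_pos: "student_density \<alpha> \<nu> \<theta> y > 0"
  using kernel_base_pos[of "y - fst \<theta>"] mass_pos
  by (simp add: student_density_eq student_kernel_def powr_gt_zero)

lemma has_bochner_integral_density: "has_bochner_integral lborel (student_density \<alpha> \<nu> \<theta>) 1"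
  using has_bochner_integral_mult_right[OF has_bochner_integral_kernel, of "1 / mass"] mass_pos
  by (simp add: student_density_eq[abs_def])

lemma has_bochner_integral_density_inner:
  "has_bochner_integral lborel (\<lambda>y. student_density \<alpha> \<nu> \<theta> y * (v \<bullet> (y - fst \<theta>))) 0"
proof -
  have "has_bochner_integral lborel (\<lambda>y. \<Sum>i\<in>UNIV. v $ i / mass * (student_kernel \<alpha> \<nu> \<theta> y * (y - fst \<theta>) $ i)) (\<Sum>i\<in>UNIV. v $ i / mass * 0)"
    by (intro has_bochner_integral_sum has_bochner_integral_mult_right has_bochner_integral_kernel_linear)
  then show ?thesis
    by (simp add: student_density_eq inner_vec_def sum_distrib_left sum_divide_distrib mult_ac)
qed

lemma has_bochner_integral_density_quadratic:
  "has_bochner_integral lborel (\<lambda>y. student_density \<alpha> \<nu> \<theta> y * ((y - fst \<theta>) \<bullet> (M *v (y - fst \<theta>))))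
     (\<nu> / (\<nu> - 2) * trace (M ** snd \<theta>))"
proof -
  let ?c = "\<nu> / (\<nu> - 2)"
  have "has_bochner_integral lborel
     (\<lambda>y. \<Sum>i\<in>UNIV. \<Sum>j\<in>UNIV. M $ i $ j / mass * (student_kernel \<alpha> \<nu> \<theta> y * ((y - fst \<theta>) $ i * (y - fst \<theta>) $ j)))
     (\<Sum>i\<in>UNIV. \<Sum>j\<in>UNIV. M $ i $ j / mass * (mass * (?c * snd \<theta> $ i $ j)))"
    by (intro has_bochner_integral_sum has_bochner_integral_mult_right has_bochner_integral_kernel_product)
  moreover have "(\<Sum>i\<in>UNIV. \<Sum>j\<in>UNIV. M $ i $ j / mass * (mass * (?c * snd \<theta> $ i $ j))) = ?c * trace (M ** snd \<theta>)"
  proof -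
    have "snd \<theta> $ i $ j = snd \<theta> $ j $ i" for i j
      using arg_cong[OF pos_def_transpose[OF scale], of "\<lambda>M. M $ j $ i"] by (simp add: transpose_def)
    then show ?thesis
      using mass_pos by (simp add: trace_def matrix_matrix_mult_def sum_distrib_left mult_ac)
  qed
  moreover have "(\<Sum>i\<in>UNIV. \<Sum>j\<in>UNIV. M $ i $ j / mass * (student_kernel \<alpha> \<nu> \<theta> y * ((y - fst \<theta>) $ i * (y - fst \<theta>) $ j)))
     = student_density \<alpha> \<nu> \<theta> y * ((y - fst \<theta>) \<bullet> (M *v (y - fst \<theta>)))" for y
    by (simp add: student_density_eq inner_vec_def matrix_vector_mult_def sum_distrib_left sum_divide_distrib mult_ac)
  ultimately show ?thesis by simp
qed

section \<open>The score and the two sides of the estimating equations\<close>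

abbreviation P :: "real ^ 'n ^ 'n" where "P \<equiv> matrix_inv (snd \<theta>)"

definition base :: "real ^ 'n \<Rightarrow> real" where
  "base y = 1 + 1 / \<nu> * ((y - fst \<theta>) \<bullet> (P *v (y - fst \<theta>)))"

lemma base_pos: "base y > 0"
  unfolding base_def by (rule kernel_base_pos)

lemma ln_density: "ln (student_density \<alpha> \<nu> \<theta> y) =
  - ((\<nu> + real CARD('n)) / 2) * ln (base y) - ln (student_volume \<nu> TYPE('n)) - ln (det (snd \<theta>)) / 2"
proof -
  have "ln (student_density \<alpha> \<nu> \<theta> y) = ln (base y powr (- ((\<nu> + real CARD('n)) / 2))) - ln mass"
    unfolding student_density_eq using mass_pos base_pos[of y]
    by (subst ln_div) (auto simp: student_kernel_def exponent base_def)
  also have "ln mass = ln (student_volume \<nu> TYPE('n)) + ln (det (snd \<theta>)) / 2"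
    unfolding mass_def using nu student_volume_pos[of \<nu>, where 'n = 'n] pos_def_det_pos[OF scale]
    by (subst ln_mult) (auto simp: ln_sqrt)
  finally show ?thesis using base_pos[of y] by (simp add: ln_powr)
qed

lemma has_derivative_quadratic_line:
  assumes E: "transpose E = E"
  shows "((\<lambda>h. (y - h *\<^sub>R v) \<bullet> (matrix_inv (snd \<theta> + h *\<^sub>R E) *v (y - h *\<^sub>R v))) has_real_derivative
     - (2 * (v \<bullet> (P *v y)) + (P *v y) \<bullet> (E *v (P *v y)))) (at 0)"
proof -
  let ?G = "\<lambda>h. matrix_inv (snd \<theta> + h *\<^sub>R E)"
  note D = has_derivative_matrix_inv_line[OF scale E]
  \<comment> \<open>Bilinear expansion: in each term the inverse stands between fixed vectors, so
    its known derivative and the product rule apply.\<close>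
  let ?f = "\<lambda>h. y \<bullet> (?G h *v y) - h * (v \<bullet> (?G h *v y)) - h * (y \<bullet> (?G h *v v)) + h * (h * (v \<bullet> (?G h *v v)))"
  have "(?f has_real_derivative
     - ((P *v y) \<bullet> (E *v (P *v y)))
     - (0 * - ((P *v v) \<bullet> (E *v (P *v y))) + 1 * (v \<bullet> (?G 0 *v y)))
     - (0 * - ((P *v y) \<bullet> (E *v (P *v v))) + 1 * (y \<bullet> (?G 0 *v v)))
     + (0 * (0 * - ((P *v v) \<bullet> (E *v (P *v v))) + 1 * (v \<bullet> (?G 0 *v v))) + 1 * (0 * (v \<bullet> (?G 0 *v v))))) (at 0)"
    by (intro DERIV_add DERIV_diff DERIV_mult' DERIV_ident D)
  moreover have "y \<bullet> (P *v v) = v \<bullet> (P *v y)"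
    using matrix_vector_mult_inner_transpose[of y P v] pos_def_transpose[OF pos_def_inv[OF scale]]
    by (simp add: inner_commute)
  ultimately have "(?f has_real_derivative - (2 * (v \<bullet> (P *v y)) + (P *v y) \<bullet> (E *v (P *v y)))) (at 0)"
    by simp
  moreover have "?f = (\<lambda>h. (y - h *\<^sub>R v) \<bullet> (?G h *v (y - h *\<^sub>R v)))"
    by (simp add: fun_eq_iff matrix_vector_mult_diff_distrib matrix_vector_mult_scaleR inner_diff_left inner_diff_right right_diff_distrib)
  ultimately show ?thesis by simp
qed

lemma score_eq:
  "score \<alpha> \<nu> \<theta> c y = (\<nu> + real CARD('n)) / (2 * \<nu>)
      * (2 * (loc_direction c \<bullet> (P *v (y - fst \<theta>)))
         + (P *v (y - fst \<theta>)) \<bullet> (scale_direction c *v (P *v (y - fst \<theta>)))) / base y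
      - trace (P ** scale_direction c) / 2"
proof -
  let ?v = "loc_direction c" and ?E = "scale_direction c" and ?b = "(\<nu> + real CARD('n)) / 2"
  let ?q = "\<lambda>h. (y - fst \<theta> - h *\<^sub>R ?v) \<bullet> (matrix_inv (snd \<theta> + h *\<^sub>R ?E) *v (y - fst \<theta> - h *\<^sub>R ?v))"
  let ?L = "\<lambda>h. - ?b * ln (1 + 1 / \<nu> * ?q h) - ln (student_volume \<nu> TYPE('n)) - ln (det (snd \<theta> + h *\<^sub>R ?E)) / 2"
  let ?q' = "- (2 * (?v \<bullet> (P *v (y - fst \<theta>))) + (P *v (y - fst \<theta>)) \<bullet> (?E *v (P *v (y - fst \<theta>))))"
  have base: "1 + 1 / \<nu> * ?q 0 = base y" by (simp add: base_def)
  have "((\<lambda>h. 1 + 1 / \<nu> * ?q h) has_real_derivative 0 + 1 / \<nu> * ?q') (at 0)"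
    by (intro DERIV_add DERIV_const DERIV_cmult has_derivative_quadratic_line transpose_scale_direction)
  from DERIV_chain2[OF DERIV_ln_divide this, unfolded base, OF base_pos]
  have "((\<lambda>h. ln (1 + 1 / \<nu> * ?q h)) has_real_derivative 1 / base y * (0 + 1 / \<nu> * ?q')) (at 0)" .
  then have "(?L has_real_derivative
      - ?b * (1 / base y * (0 + 1 / \<nu> * ?q')) - 0 - trace (P ** ?E) / 2) (at 0)"
    by (intro DERIV_diff DERIV_cmult DERIV_const DERIV_cdivide has_real_derivative_ln_det_line[OF scale])
  \<comment> \<open>The explicit formula for the log density holds only for positive definite scale
    matrices. Agreement near h = 0 is enough for the derivative.\<close>
  moreover have "\<forall>\<^sub>F h in nhds 0. ?L h = ln (student_density \<alpha> \<nu> (set_coord \<theta> c (h + get_coord \<theta> c)) y)"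
  proof -
    obtain \<epsilon> where "\<forall>\<^sub>F h in nhds 0. pos_def (snd \<theta> + h *\<^sub>R ?E) \<and>
        (\<forall>x. x \<bullet> ((snd \<theta> + h *\<^sub>R ?E) *v x) \<ge> \<epsilon> * (norm x)\<^sup>2)"
      using eventually_pos_def[OF scale transpose_scale_direction] by blast
    then show ?thesis
    proof (rule eventually_mono)
      fix h assume "pos_def (snd \<theta> + h *\<^sub>R ?E) \<and>
        (\<forall>x. x \<bullet> ((snd \<theta> + h *\<^sub>R ?E) *v x) \<ge> \<epsilon> * (norm x)\<^sup>2)"
      then interpret line: student \<alpha> \<nu> "(fst \<theta> + h *\<^sub>R ?v, snd \<theta> + h *\<^sub>R ?E)"
        using nu by unfold_locales auto
      have "set_coord \<theta> c (h + get_coord \<theta> c) = (fst \<theta> + h *\<^sub>R ?v, snd \<theta> + h *\<^sub>R ?E)"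
        using set_coord_eq_line[OF pos_def_transpose[OF scale], of c h] by (simp add: add.commute)
      then show "?L h = ln (student_density \<alpha> \<nu> (set_coord \<theta> c (h + get_coord \<theta> c)) y)"
        by (simp only: line.ln_density line.base_def fst_conv snd_conv diff_diff_eq)
    qed
  qed
  ultimately have "((\<lambda>h. ln (student_density \<alpha> \<nu> (set_coord \<theta> c (h + get_coord \<theta> c)) y)) has_real_derivative
      - ?b * (1 / base y * (0 + 1 / \<nu> * ?q')) - 0 - trace (P ** ?E) / 2) (at 0)"
    using DERIV_cong_ev[OF refl _ refl, of ?L "\<lambda>h. ln (student_density \<alpha> \<nu> (set_coord \<theta> c (h + get_coord \<theta> c)) y)" 0] by blast
  then have "((\<lambda>t. ln (student_density \<alpha> \<nu> (set_coord \<theta> c t) y)) has_real_derivative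
      - ?b * (1 / base y * (0 + 1 / \<nu> * ?q')) - 0 - trace (P ** ?E) / 2) (at (0 + get_coord \<theta> c))"
    by (subst DERIV_shift)
  then have "score \<alpha> \<nu> \<theta> c y = - ?b * (1 / base y * (0 + 1 / \<nu> * ?q')) - 0 - trace (P ** ?E) / 2"
    unfolding score_def by (simp add: DERIV_imp_deriv)
  also have "\<dots> = (\<nu> + real CARD('n)) / (2 * \<nu>) * (- ?q') / base y - trace (P ** ?E) / 2"
  proof -
    have "- (b / 2) * (1 / u * (0 + 1 / \<nu> * q)) - 0 - t = b / (2 * \<nu>) * (- q) / u - t" for b u q t
      by simp
    then show ?thesis .
  qed
  finally show ?thesis by simp
qed

text \<open>What the normalization leaves of p^(\<alpha> - 1); the kernel raised to this power is
  just \<open>base\<close>.\<close>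

definition weight :: real where "weight = mass powr (1 - \<alpha>)"

lemma weight_pos: "weight > 0"
  using mass_pos by (simp add: weight_def)

lemma density_powr: "student_density \<alpha> \<nu> \<theta> y powr (\<alpha> - 1) = weight * base y"
proof -
  have "\<alpha> - 1 \<noteq> 0" using nu by simp
  then have "(base y powr (1 / (\<alpha> - 1))) powr (\<alpha> - 1) = base y"
    using base_pos[of y] by (simp add: powr_powr)
  moreover have "mass powr (1 - \<alpha>) = 1 / mass powr (\<alpha> - 1)"
    using powr_minus_divide[of mass "\<alpha> - 1"] by simp
  ultimately show ?thesis
    using mass_pos unfolding student_density_eq student_kernel_def base_def[symmetric]
    by (simp add: powr_divide weight_def)
qed

text \<open>Splitting off one factor of the density turns the integrals of the model side into
  moments of the Student law.\<close>

lemma density_powr_alpha: "student_density \<alpha> \<nu> \<theta> y powr \<alpha> = student_density \<alpha> \<nu> \<theta> y * (weight * base y)"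
  using student_density_pos[of y] powr_add[of "student_density \<alpha> \<nu> \<theta> y" 1 "\<alpha> - 1"]
  by (simp add: density_powr)

text \<open>The common shape of both sides of the estimating equation as a function of a first
  moment \<open>m\<close> and a second moment \<open>S\<close> about the location: the sample
  inserts its averages, the model inserts 0 and K.\<close>

definition score_form :: "'n coord \<Rightarrow> real ^ 'n \<Rightarrow> real ^ 'n ^ 'n \<Rightarrow> real" where
  "score_form c m S = weight / 2 * ((\<nu> + real CARD('n)) / \<nu> *
       (2 * (loc_direction c \<bullet> (P *v m)) + trace (P ** scale_direction c ** P ** S))
     - trace (P ** scale_direction c) * (1 + trace (P ** S) / \<nu>))"

text \<open>The factor \<open>base y\<close> from the density power cancels the denominator of the
  score.\<close>

lemma weighted_score:
  "student_density \<alpha> \<nu> \<theta> y powr (\<alpha> - 1) * score \<alpha> \<nu> \<theta> c y = weight / 2 *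
     ((\<nu> + real CARD('n)) / \<nu> * (2 * ((P *v loc_direction c) \<bullet> (y - fst \<theta>))
        + (y - fst \<theta>) \<bullet> (P ** scale_direction c ** P *v (y - fst \<theta>)))
     - trace (P ** scale_direction c) * base y)"
proof -
  note sym = pos_def_transpose[OF pos_def_inv[OF scale]]
  have "loc_direction c \<bullet> (P *v (y - fst \<theta>)) = (P *v loc_direction c) \<bullet> (y - fst \<theta>)"
    using matrix_vector_mult_inner_transpose[of _ P] by (simp only: sym)
  moreover have "(P *v (y - fst \<theta>)) \<bullet> (scale_direction c *v (P *v (y - fst \<theta>)))
      = (y - fst \<theta>) \<bullet> (P ** scale_direction c ** P *v (y - fst \<theta>))"
    using matrix_vector_mult_inner_transpose[of "y - fst \<theta>" P "scale_direction c *v (P *v (y - fst \<theta>))"]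
    by (simp only: sym matrix_vector_mul_assoc[symmetric])
  moreover have "weight * u * ((\<nu> + real CARD('n)) / (2 * \<nu>) * l / u - t / 2)
      = weight / 2 * ((\<nu> + real CARD('n)) / \<nu> * l - t * u)" if "u > 0" for u l t
    using that nu by (simp add: field_simps)
  ultimately show ?thesis
    unfolding density_powr score_eq using base_pos[of y] by simp
qed

lemma has_bochner_integral_density_base:
  "has_bochner_integral lborel (\<lambda>y. student_density \<alpha> \<nu> \<theta> y * base y)
    (1 + 1 / \<nu> * (\<nu> / (\<nu> - 2) * trace (P ** snd \<theta>)))"
proof -
  have "has_bochner_integral lborel
     (\<lambda>y. student_density \<alpha> \<nu> \<theta> y + 1 / \<nu> * (student_density \<alpha> \<nu> \<theta> y * ((y - fst \<theta>) \<bullet> (P *v (y - fst \<theta>)))))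
     (1 + 1 / \<nu> * (\<nu> / (\<nu> - 2) * trace (P ** snd \<theta>)))"
    by (intro has_bochner_integral_add has_bochner_integral_mult_right
        has_bochner_integral_density has_bochner_integral_density_quadratic)
  then show ?thesis by (simp add: base_def distrib_left)
qed

lemma integral_density_powr:
  "(LINT y|lborel. student_density \<alpha> \<nu> \<theta> y powr \<alpha>) = weight * (1 + trace (P ** ((\<nu> / (\<nu> - 2)) *\<^sub>R snd \<theta>)) / \<nu>)"
proof -
  have "has_bochner_integral lborel (\<lambda>y. weight * (student_density \<alpha> \<nu> \<theta> y * base y))
    (weight * (1 + 1 / \<nu> * (\<nu> / (\<nu> - 2) * trace (P ** snd \<theta>))))"
    by (intro has_bochner_integral_mult_right has_bochner_integral_density_base)
  then show ?thesis
    by (simp add: density_powr_alpha has_bochner_integral_iff matrix_mult_scaleR trace_scaleR mult_ac)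
qed

lemma integral_weighted_score:
  "(LINT y|lborel. student_density \<alpha> \<nu> \<theta> y powr \<alpha> * score \<alpha> \<nu> \<theta> c y)
    = score_form c 0 ((\<nu> / (\<nu> - 2)) *\<^sub>R snd \<theta>)"
proof -
  let ?p = "student_density \<alpha> \<nu> \<theta>" and ?M = "P ** scale_direction c ** P"
  let ?k = "(\<nu> + real CARD('n)) / \<nu>" and ?t = "trace (P ** scale_direction c)"
  have eq: "?p y powr \<alpha> * score \<alpha> \<nu> \<theta> c y = weight / 2 *
     (?k * (2 * (?p y * ((P *v loc_direction c) \<bullet> (y - fst \<theta>)))
        + ?p y * ((y - fst \<theta>) \<bullet> (?M *v (y - fst \<theta>)))) - ?t * (?p y * base y))" for y
  proof -
    have "?p y powr \<alpha> * score \<alpha> \<nu> \<theta> c y = ?p y * (?p y powr (\<alpha> - 1) * score \<alpha> \<nu> \<theta> c y)"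
      by (simp add: density_powr density_powr_alpha)
    moreover have "p * (w * (k * (2 * f + g) - t * h)) = w * (k * (2 * (p * f) + p * g) - t * (p * h))"
      for p w k f g t h :: real
      by (simp add: algebra_simps)
    ultimately show ?thesis
      by (simp only: weighted_score)
  qed
  have "has_bochner_integral lborel (\<lambda>y. ?p y powr \<alpha> * score \<alpha> \<nu> \<theta> c y) (weight / 2 *
     (?k * (2 * 0 + \<nu> / (\<nu> - 2) * trace (?M ** snd \<theta>))
      - ?t * (1 + 1 / \<nu> * (\<nu> / (\<nu> - 2) * trace (P ** snd \<theta>)))))"
    unfolding eq
    by (intro has_bochner_integral_mult_right has_bochner_integral_diff has_bochner_integral_add
        has_bochner_integral_density_inner has_bochner_integral_density_quadratic has_bochner_integral_density_base)
  then show ?thesis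
    by (simp add: has_bochner_integral_iff score_form_def matrix_mult_scaleR trace_scaleR)
qed

lemma average_base:
  assumes "n \<ge> 1"
  shows "(1 / real n) * (\<Sum>r = 1..n. base (x r)) = 1 + trace (P ** second_moment n x (fst \<theta>)) / \<nu>"
  using assms unfolding average_quadratic[symmetric] base_def
  by (simp add: sum.distrib field_simps sum_divide_distrib[symmetric])

lemma average_density_powr:
  assumes "n \<ge> 1"
  shows "(1 / real n) * (\<Sum>r = 1..n. student_density \<alpha> \<nu> \<theta> (x r) powr (\<alpha> - 1))
    = weight * (1 + trace (P ** second_moment n x (fst \<theta>)) / \<nu>)"
  unfolding density_powr average_base[OF assms, symmetric] by (simp add: sum_distrib_left)

lemma average_weighted_score:
  assumes "n \<ge> 1"
  shows "(1 / real n) * (\<Sum>r = 1..n. student_density \<alpha> \<nu> \<theta> (x r) powr (\<alpha> - 1) * score \<alpha> \<nu> \<theta> c (x r))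
    = score_form c (mean_deviation n x (fst \<theta>)) (second_moment n x (fst \<theta>))"
proof -
  let ?y = "\<lambda>r. x r - fst \<theta>" and ?M = "P ** scale_direction c ** P"
  let ?k = "(\<nu> + real CARD('n)) / \<nu>" and ?t = "trace (P ** scale_direction c)"
  let ?A = "\<lambda>f. (1 / real n) * (\<Sum>r = 1..n. f r)"
  have "?A (\<lambda>r. w * (k * (2 * f r + g r) - t * h r)) = w * (k * (2 * ?A f + ?A g) - t * ?A h)"
    for w k t and f g h :: "nat \<Rightarrow> real"
    by (simp only: sum.distrib sum_subtractf sum_distrib_left[symmetric]) (simp add: algebra_simps)
  from this[of "weight / 2" ?k "\<lambda>r. (P *v loc_direction c) \<bullet> ?y r" "\<lambda>r. ?y r \<bullet> (?M *v ?y r)" ?t "\<lambda>r. base (x r)"]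
  have "?A (\<lambda>r. weight / 2 * (?k * (2 * ((P *v loc_direction c) \<bullet> ?y r) + ?y r \<bullet> (?M *v ?y r)) - ?t * base (x r)))
      = weight / 2 * (?k * (2 * ?A (\<lambda>r. (P *v loc_direction c) \<bullet> ?y r) + ?A (\<lambda>r. ?y r \<bullet> (?M *v ?y r))) - ?t * ?A (\<lambda>r. base (x r)))" .
  moreover have "(P *v loc_direction c) \<bullet> m = loc_direction c \<bullet> (P *v m)" for m
    using matrix_vector_mult_inner_transpose[of "loc_direction c" P m]
    by (simp only: pos_def_transpose[OF pos_def_inv[OF scale]])
  ultimately show ?thesis
    unfolding weighted_score score_form_def average_inner average_quadratic average_base[OF assms]
    by simp
qed

section \<open>Solving the moment equations\<close>

lemma trace_inv_scale: "trace (P ** snd \<theta>) = real CARD('n)"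
  by (simp add: pos_def_inv_left[OF scale] trace_I)

lemma scale_conjugate:
  "snd \<theta> ** (P ** X ** P) ** snd \<theta> = X" "P ** snd \<theta> ** P = P"
proof -
  have "snd \<theta> ** (P ** X ** P) ** snd \<theta> = (snd \<theta> ** P) ** X ** (P ** snd \<theta>)"
    by (simp only: matrix_mul_assoc)
  then show "snd \<theta> ** (P ** X ** P) ** snd \<theta> = X"
    by (simp add: pos_def_inv_left[OF scale] pos_def_inv_right[OF scale])
  show "P ** snd \<theta> ** P = P" by (simp add: pos_def_inv_left[OF scale])
qed

lemma trace_sandwich: "trace (P ** E ** P ** S) = trace (E ** (P ** S ** P))"
  by (metis matrix_mul_assoc trace_mul_sym)

text \<open>By cyclicity of the trace the hypothesis says that P S P - a P pairs to zero with every
  scale direction. It is symmetric, so it vanishes, and conjugation by the scale matrix undoes the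
  two factors \<open>P\<close>.\<close>

lemma symmetric_proportional:
  fixes S :: "real ^ 'n ^ 'n"
  assumes S: "transpose S = S"
    and eq: "\<And>i j. trace (P ** scale_direction (Scale i j) ** P ** S) = a * trace (P ** scale_direction (Scale i j))"
  shows "S = a *\<^sub>R snd \<theta>"
proof -
  note P = pos_def_transpose[OF pos_def_inv[OF scale]]
  let ?X = "P ** S ** P - a *\<^sub>R P"
  have "?X = 0"
  proof (rule symmetric_eq_0_if_trace)
    have "transpose (P ** S ** P) = P ** S ** P"
      by (simp add: matrix_transpose_mul P S matrix_mul_assoc)
    moreover have "transpose (A - a *\<^sub>R B) = transpose A - a *\<^sub>R transpose B" for A B :: "real ^ 'n ^ 'n"
      by (simp add: vec_eq_iff transpose_def)
    ultimately show "transpose ?X = ?X" by (simp only: P)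
  next
    fix i j :: 'n
    let ?E = "scale_direction (Scale i j)"
    have "?E ** ?X = ?E ** (P ** S ** P) - a *\<^sub>R (?E ** P)"
      by (simp add: matrix_mult_diff_distrib matrix_mult_scaleR)
    then have "trace (?E ** ?X) = trace (P ** ?E ** P ** S) - a * trace (P ** ?E)"
      by (simp only: trace_sub trace_scaleR trace_sandwich trace_mul_sym[of P])
    then show "trace (?E ** ?X) = 0" using eq[of i j] by simp
  qed
  then have "P ** S ** P = a *\<^sub>R (P ** snd \<theta> ** P)" by (simp add: scale_conjugate)
  also have "\<dots> = P ** (a *\<^sub>R snd \<theta>) ** P"
    by (simp add: matrix_mult_scaleR scalar_matrix_assoc[symmetric])
  finally show ?thesis by (metis scale_conjugate(1))
qed

lemma location_zero:
  assumes "\<And>i. axis i 1 \<bullet> (P *v m) = 0" shows "m = 0"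
proof -
  have "P *v m = 0" using assms by (simp add: vec_eq_iff inner_axis')
  then have "snd \<theta> *v (P *v m) = 0" by simp
  then show ?thesis by (simp only: matrix_vector_mul_assoc pos_def_inv_right[OF scale] matrix_vector_mul_lid)
qed

text \<open>The scale equations are coupled only through t = tr(P S) - tr(P K). They give S - K =
  t/(\<nu> + d) times the scale matrix; the trace against \<open>P\<close> then returns t = t
  d/(\<nu> + d), so t \<nu> = 0.\<close>

lemma estimating_equation_unique:
  fixes S :: "real ^ 'n ^ 'n"
  defines "K \<equiv> (\<nu> / (\<nu> - 2)) *\<^sub>R snd \<theta>"
  assumes S: "transpose S = S" and eq: "\<And>c. score_form c m S = score_form c 0 K"
  shows "m = 0 \<and> S = K"
proof
  let ?d = "real CARD('n)" and ?t = "trace (P ** S) - trace (P ** K)"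
  \<comment> \<open>Along a location coordinate \<open>scale_direction\<close> is zero, so both
    trace terms drop out.\<close>
  have "axis i 1 \<bullet> (P *v m) = 0" for i
    using eq[of "Loc i"] weight_pos nu(1)
    by (simp add: score_form_def trace_def matrix_matrix_mult_def)
  then show "m = 0" by (rule location_zero)
  have "trace (P ** scale_direction (Scale i j) ** P ** S) =
      (\<nu> / (\<nu> - 2) + ?t / (\<nu> + ?d)) * trace (P ** scale_direction (Scale i j))" for i j
  proof -
    let ?E = "scale_direction (Scale i j)"
    have K: "trace (P ** ?E ** P ** K) = \<nu> / (\<nu> - 2) * trace (P ** ?E)"
      by (simp add: K_def matrix_mult_scaleR trace_scaleR matrix_mul_assoc[symmetric] pos_def_inv_left[OF scale])
    from eq[of "Scale i j"] have "(\<nu> + ?d) / \<nu> * trace (P ** ?E ** P ** S) - trace (P ** ?E) * (1 + trace (P ** S) / \<nu>)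
        = (\<nu> + ?d) / \<nu> * trace (P ** ?E ** P ** K) - trace (P ** ?E) * (1 + trace (P ** K) / \<nu>)"
      using weight_pos by (simp add: score_form_def)
    then have "(\<nu> + ?d) / \<nu> * (trace (P ** ?E ** P ** S) - trace (P ** ?E ** P ** K)) = trace (P ** ?E) * ?t / \<nu>"
      by (simp add: algebra_simps add_divide_distrib diff_divide_distrib)
    then have "(\<nu> + ?d) * (trace (P ** ?E ** P ** S) - trace (P ** ?E ** P ** K)) = trace (P ** ?E) * ?t"
      using nu by (simp add: field_simps)
    then have "trace (P ** ?E ** P ** S) - trace (P ** ?E ** P ** K) = trace (P ** ?E) * ?t / (\<nu> + ?d)"
      using nu by (simp add: nonzero_eq_divide_eq mult.commute add_pos_nonneg)
    moreover have "x = (c + t / N) * e" if "x - y = e * t / N" "y = c * e" for x y c t N e :: real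
      using that by (simp add: algebra_simps)
    ultimately show ?thesis using K by blast
  qed
  from symmetric_proportional[OF S this]
  have SK: "S = K + (?t / (\<nu> + ?d)) *\<^sub>R snd \<theta>"
    by (simp add: K_def scaleR_add_left)
  then have "trace (P ** S) = trace (P ** (K + (?t / (\<nu> + ?d)) *\<^sub>R snd \<theta>))" by (rule arg_cong)
  then have "?t = ?t / (\<nu> + ?d) * ?d"
    by (simp add: matrix_add_ldistrib trace_add matrix_mult_scaleR trace_scaleR trace_inv_scale)
  then have "?t * \<nu> = 0"
    using nu by (simp add: field_simps add_pos_nonneg)
  then have "?t = 0" using nu by simp
  with SK show "S = K" by simp
qed

text \<open>Division by \<open>weight * U T\<close> makes the last term of \<open>score_form\<close>
  independent of the moments, so it cancels between the two sides. What remains compares S/U(S) with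
  K/U(K) and determines S up to the factor U(S)/U(K).\<close>

lemma normalized_estimating_equation_unique:
  fixes S :: "real ^ 'n ^ 'n"
  defines "K \<equiv> (\<nu> / (\<nu> - 2)) *\<^sub>R snd \<theta>"
  defines "U \<equiv> (\<lambda>T :: real ^ 'n ^ 'n. 1 + trace (P ** T) / \<nu>)"
  assumes S: "transpose S = S" and pos: "U S > 0"
    and eq: "\<And>c. score_form c m S / (weight * U S) = score_form c 0 K / (weight * U K)"
  shows "m = 0 \<and> S = K"
proof
  have UK: "U K = 1 + real CARD('n) / (\<nu> - 2)"
    using nu by (simp add: U_def K_def matrix_mult_scaleR trace_scaleR trace_inv_scale)
  have posK: "U K > 0" unfolding UK using nu by (intro add_pos_nonneg) auto
  have nd: "\<nu> + real CARD('n) > 0" using nu by (intro add_pos_nonneg) auto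
  have form: "score_form c m T / (weight * U T) = ((\<nu> + real CARD('n)) / \<nu> *
       (2 * (loc_direction c \<bullet> (P *v m)) + trace (P ** scale_direction c ** P ** T)) / U T
     - trace (P ** scale_direction c)) / 2" if "U T > 0" for c m T
  proof -
    have "w / 2 * (a - t * u) / (w * u) = (a / u - t) / 2" if "w > 0" "u > 0" for w u a t :: real
      using that by (simp add: field_simps)
    from this[OF weight_pos that] show ?thesis by (simp only: score_form_def U_def)
  qed
  have eq': "(2 * (loc_direction c \<bullet> (P *v m)) + trace (P ** scale_direction c ** P ** S)) / U S
      = trace (P ** scale_direction c ** P ** K) / U K" for c
  proof -
    have cancel: "a / s = b / r" if "(k * a / s - t) / 2 = (k * b / r - t) / 2" "k > 0" for k a b s r t :: real
    proof -
      have "k * (a / s) = k * (b / r)" using arg_cong[OF that(1), of "\<lambda>z. 2 * z + t"] by simp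
      then show ?thesis using that(2) by (simp only: mult_cancel_left) simp
    qed
    have "(\<nu> + real CARD('n)) / \<nu> > 0" using nu nd by simp
    from cancel[OF eq[of c, unfolded form[OF pos] form[OF posK]] this]
    show ?thesis by simp
  qed
  have "axis i 1 \<bullet> (P *v m) = 0" for i
    using eq'[of "Loc i"] pos by (simp add: trace_def matrix_matrix_mult_def)
  then show "m = 0" by (rule location_zero)
  have "trace (P ** scale_direction (Scale i j) ** P ** S) =
      (U S / U K * (\<nu> / (\<nu> - 2))) * trace (P ** scale_direction (Scale i j))" for i j
  proof -
    let ?E = "scale_direction (Scale i j)"
    have K: "trace (P ** ?E ** P ** K) = \<nu> / (\<nu> - 2) * trace (P ** ?E)"
      by (simp add: K_def matrix_mult_scaleR trace_scaleR matrix_mul_assoc[symmetric] pos_def_inv_left[OF scale])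
    have "x = (s / r * c) * e" if "x / s = y / r" "y = c * e" "s > 0" for x s y r c e :: real
    proof -
      have "x = s * (x / s)" using that(3) by simp
      then show ?thesis unfolding that(1,2) by simp
    qed
    moreover have "trace (P ** ?E ** P ** S) / U S = trace (P ** ?E ** P ** K) / U K"
      using eq'[of "Scale i j"] by simp
    ultimately show ?thesis using K pos by blast
  qed
  from symmetric_proportional[OF S this]
  have SK: "S = (U S / U K) *\<^sub>R K" by (simp add: K_def)
  then have "trace (P ** S) = U S / U K * trace (P ** K)"
    by (metis matrix_mult_scaleR trace_scaleR)
  \<comment> \<open>The constant 1 in \<open>U\<close> breaks the homogeneity and forces the factor
    to be 1; with the trace alone, every positive multiple of K would pass.\<close>
  then have "U S - 1 = U S / U K * (U K - 1)"
    unfolding U_def by simp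
  then have "U S = U K" using posK by (simp add: field_simps)
  with SK posK show "S = K" by simp
qed

lemma score_form_commute: "score_form (Scale j i) = score_form (Scale i j)"
  by (simp add: fun_eq_iff score_form_def scale_direction_commute[of j i] del: scale_direction.simps)

end

section \<open>From the equations to the sets of estimates\<close>

text \<open>Equations are imposed only for i \<le> j, while the matrix argument tests all pairs; the
  missing ones are copies, since (i, j) and (j, i) give the same direction.\<close>

lemma all_coords_if_free_coords:
  assumes "\<And>c. c \<in> free_coords \<Longrightarrow> Q c" "\<And>i j. Q (Scale j i) \<longleftrightarrow> Q (Scale i j)"
  shows "Q c"
proof (cases c)
  case (Loc i)
  then show ?thesis using assms(1) by (simp add: free_coords_def)
next
  case (Scale i j)
  then show ?thesis
    using assms(1)[of "Scale i j"] assms(1)[of "Scale j i"] assms(2)[of i j] linear[of i j]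
    by (auto simp: free_coords_def)
qed

text \<open>Equal moments make both sides literally the same expression, so only the uniqueness
  direction has content.\<close>

lemma
  fixes \<theta> :: "'n::{finite,linorder} student_param"
  assumes student: "student \<alpha> \<nu> \<theta>" and n: "n \<ge> 1"
  shows basu_equation_iff: "basu_equation \<alpha> \<nu> n x \<theta> \<longleftrightarrow>
      mean_deviation n x (fst \<theta>) = 0 \<and> second_moment n x (fst \<theta>) = (\<nu> / (\<nu> - 2)) *\<^sub>R snd \<theta>" (is "_ \<longleftrightarrow> ?m = 0 \<and> ?S = ?K")
    and jones_equation_iff: "jones_equation \<alpha> \<nu> n x \<theta> \<longleftrightarrow>
      mean_deviation n x (fst \<theta>) = 0 \<and> second_moment n x (fst \<theta>) = (\<nu> / (\<nu> - 2)) *\<^sub>R snd \<theta>"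
proof -
  interpret student \<alpha> \<nu> \<theta> by (rule student)
  have "?m = 0 \<and> ?S = ?K"
    if "\<forall>c\<in>free_coords. score_form c ?m ?S = score_form c 0 ?K"
  proof (rule estimating_equation_unique[OF transpose_second_moment])
    show "score_form c ?m ?S = score_form c 0 ?K" for c
    proof (rule all_coords_if_free_coords[where Q = "\<lambda>c. score_form c ?m ?S = score_form c 0 ?K"])
      show "score_form (Scale j i) ?m ?S = score_form (Scale j i) 0 ?K
          \<longleftrightarrow> score_form (Scale i j) ?m ?S = score_form (Scale i j) 0 ?K" for i j
        by (simp only: score_form_commute[of j i])
    qed (use that in blast)
  qed
  then show "basu_equation \<alpha> \<nu> n x \<theta> \<longleftrightarrow> ?m = 0 \<and> ?S = ?K"
    unfolding basu_equation_def average_weighted_score[OF n] integral_weighted_score by auto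
  let ?U = "\<lambda>T. weight * (1 + trace (P ** T) / \<nu>)"
  \<comment> \<open>Up to \<open>weight\<close>, the denominator of the Jones equation is a sample
    average of the positive function \<open>base\<close>, so the division is genuine.\<close>
  have "(1 / real n) * (\<Sum>r = 1..n. base (x r)) > 0"
    using n base_pos by (intro mult_pos_pos sum_pos) auto
  then have pos: "1 + trace (P ** ?S) / \<nu> > 0"
    by (simp only: average_base[OF n])
  have "?m = 0 \<and> ?S = ?K"
    if "\<forall>c\<in>free_coords. score_form c ?m ?S / ?U ?S = score_form c 0 ?K / ?U ?K"
  proof (rule normalized_estimating_equation_unique[OF transpose_second_moment pos])
    show "score_form c ?m ?S / ?U ?S = score_form c 0 ?K / ?U ?K" for c
    proof (rule all_coords_if_free_coords[where Q = "\<lambda>c. score_form c ?m ?S / ?U ?S = score_form c 0 ?K / ?U ?K"])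
      show "score_form (Scale j i) ?m ?S / ?U ?S = score_form (Scale j i) 0 ?K / ?U ?K
          \<longleftrightarrow> score_form (Scale i j) ?m ?S / ?U ?S = score_form (Scale i j) 0 ?K / ?U ?K" for i j
        by (simp only: score_form_commute[of j i])
    qed (use that in blast)
  qed
  then show "jones_equation \<alpha> \<nu> n x \<theta> \<longleftrightarrow> ?m = 0 \<and> ?S = ?K"
    unfolding jones_equation_def average_weighted_score[OF n] integral_weighted_score
      average_density_powr[OF n] integral_density_powr by auto
qed

lemma second_moment_eq:
  assumes n: "n \<ge> 1" and \<mu>: "\<mu> = (1 / real n) *\<^sub>R (\<Sum>r = 1..n. x r)"
  shows "second_moment n x \<mu> $ i $ j = (1 / real n) * (\<Sum>r = 1..n. x r $ i * x r $ j) - \<mu> $ i * \<mu> $ j"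
proof -
  have s: "(\<Sum>r = 1..n. x r $ k) = real n * \<mu> $ k" for k
    using n by (simp add: \<mu>)
  have "(\<Sum>r = 1..n. (x r - \<mu>) $ i * (x r - \<mu>) $ j)
      = (\<Sum>r = 1..n. x r $ i * x r $ j) - \<mu> $ j * (\<Sum>r = 1..n. x r $ i) - \<mu> $ i * (\<Sum>r = 1..n. x r $ j) + real n * (\<mu> $ i * \<mu> $ j)"
    by (simp add: algebra_simps sum.distrib sum_subtractf sum_distrib_left)
  also have "\<dots> = (\<Sum>r = 1..n. x r $ i * x r $ j) - real n * (\<mu> $ i * \<mu> $ j)"
    unfolding s by (simp add: algebra_simps)
  finally show ?thesis
    using n by (simp add: second_moment_def diff_divide_distrib)
qed

lemma mean_deviation_eq_0_iff:
  assumes "n \<ge> 1"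
  shows "mean_deviation n x \<mu> = 0 \<longleftrightarrow> \<mu> = (1 / real n) *\<^sub>R (\<Sum>r = 1..n. x r)"
proof -
  have "mean_deviation n x \<mu> = (1 / real n) *\<^sub>R (\<Sum>r = 1..n. x r) - \<mu>"
    using assms by (simp add: mean_deviation_def sum_subtractf scaleR_diff_right sum_constant_scaleR del: sum_constant)
  then show ?thesis by auto
qed

text \<open>Only the description of the solutions by moments matters, so the equation is left as a
  parameter. Passing from \<Sigma> to K is a positive rescaling, which preserves positive
  definiteness.\<close>

lemma estimates_iff:
  fixes x :: "nat \<Rightarrow> real ^ 'd::{finite,linorder}"
  assumes nu: "\<nu> > 2" "\<alpha> = 1 - 2 / (\<nu> + real CARD('d))" and n: "n \<ge> 1"
    and eqn: "\<And>\<theta> :: 'd student_param. pos_def (snd \<theta>) \<Longrightarrow> equation \<theta> \<longleftrightarrow>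
      mean_deviation n x (fst \<theta>) = 0 \<and> second_moment n x (fst \<theta>) = (\<nu> / (\<nu> - 2)) *\<^sub>R snd \<theta>"
  shows "(\<mu>, K) \<in> {(\<mu>, (\<nu> / (\<nu> - 2)) *\<^sub>R \<Sigma>) | \<mu> \<Sigma>. pos_def \<Sigma> \<and> equation (\<mu>, \<Sigma>)} \<longleftrightarrow>
      pos_def K \<and> \<mu> = (1 / real n) *\<^sub>R (\<Sum>r = 1..n. x r)
      \<and> (\<forall>i j. i \<le> j \<longrightarrow> K $ i $ j = (1 / real n) * (\<Sum>r = 1..n. x r $ i * x r $ j) - \<mu> $ i * \<mu> $ j)"
proof -
  let ?c = "\<nu> / (\<nu> - 2)"
  have c: "?c > 0" using nu by simp
  have "(\<mu>, K) \<in> {(\<mu>, ?c *\<^sub>R \<Sigma>) | \<mu> \<Sigma>. pos_def \<Sigma> \<and> equation (\<mu>, \<Sigma>)} \<longleftrightarrow>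
      (\<exists>\<Sigma>. K = ?c *\<^sub>R \<Sigma> \<and> pos_def \<Sigma> \<and> mean_deviation n x \<mu> = 0 \<and> second_moment n x \<mu> = K)"
    using eqn by auto
  also have "\<dots> \<longleftrightarrow> pos_def K \<and> mean_deviation n x \<mu> = 0 \<and> second_moment n x \<mu> = K"
  proof (intro iffI; clarify)
    assume K: "pos_def (second_moment n x \<mu>)"
    \<comment> \<open>The witness for \<Sigma> is the second moment matrix scaled back by (\<nu> -
      2)/\<nu>.\<close>
    have eq: "second_moment n x \<mu> = ?c *\<^sub>R ((1 / ?c) *\<^sub>R second_moment n x \<mu>)"
      using nu by simp
    with K have "pos_def ((1 / ?c) *\<^sub>R second_moment n x \<mu>)" using pos_def_scaleR[OF c] by metis
    with eq show "\<exists>\<Sigma>. second_moment n x \<mu> = ?c *\<^sub>R \<Sigma> \<and> pos_def \<Sigma> \<and> mean_deviation n x \<mu> = 0 \<and> second_moment n x \<mu> = second_moment n x \<mu>"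
      if "mean_deviation n x \<mu> = 0" using that by blast
  qed (use pos_def_scaleR[OF c] in auto)
  also have "\<dots> \<longleftrightarrow> pos_def K \<and> \<mu> = (1 / real n) *\<^sub>R (\<Sum>r = 1..n. x r)
      \<and> (\<forall>i j. i \<le> j \<longrightarrow> K $ i $ j = (1 / real n) * (\<Sum>r = 1..n. x r $ i * x r $ j) - \<mu> $ i * \<mu> $ j)"
  proof (intro conj_cong refl)
    assume K: "pos_def K"
    show "mean_deviation n x \<mu> = 0 \<longleftrightarrow> \<mu> = (1 / real n) *\<^sub>R (\<Sum>r = 1..n. x r)"
      by (rule mean_deviation_eq_0_iff[OF n])
    assume \<mu>: "\<mu> = (1 / real n) *\<^sub>R (\<Sum>r = 1..n. x r)"
    \<comment> \<open>Both matrices are symmetric, \<open>K\<close> by positive definiteness, so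
      comparing the entries with i \<le> j is enough.\<close>
    have "second_moment n x \<mu> = K \<longleftrightarrow> (\<forall>i j. i \<le> j \<longrightarrow> K $ i $ j = second_moment n x \<mu> $ i $ j)"
      using symmetric_component[OF transpose_second_moment[of n x \<mu>]]
        symmetric_component[OF pos_def_transpose[OF K]]
      by (metis linear vec_eq_iff)
    then show "second_moment n x \<mu> = K \<longleftrightarrow>
        (\<forall>i j. i \<le> j \<longrightarrow> K $ i $ j = (1 / real n) * (\<Sum>r = 1..n. x r $ i * x r $ j) - \<mu> $ i * \<mu> $ j)"
      by (simp only: second_moment_eq[OF n \<mu>])
  qed
  finally show ?thesis .
qed

theorem theorem14:
  fixes \<alpha> \<nu> :: real
    and n :: nat
    and M :: "'w measure"
    and X :: "nat \<Rightarrow> 'w \<Rightarrow> real ^ 'd::{finite,linorder}"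
  assumes alpha: "real CARD('d) / (real CARD('d) + 2) < \<alpha>" "\<alpha> < 1"
    and nu: "\<nu> > 2" "\<alpha> = 1 - 2 / (\<nu> + real CARD('d))"
    and n: "n \<ge> 1"
    and prob: "prob_space M"
    and indep: "prob_space.indep_vars M (\<lambda>_. borel) X {1..n}"
    and ident: "\<forall>r\<in>{1..n}. \<forall>s\<in>{1..n}. distr M borel (X r) = distr M borel (X s)"
  shows "\<forall>\<omega>\<in>space M.
           basu_estimates \<alpha> \<nu> n (\<lambda>r. X r \<omega>) = jones_estimates \<alpha> \<nu> n (\<lambda>r. X r \<omega>)
         \<and> (\<forall>\<mu> K. (\<mu>, K) \<in> basu_estimates \<alpha> \<nu> n (\<lambda>r. X r \<omega>) \<longleftrightarrow>
              pos_def K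
            \<and> \<mu> = (1 / real n) *\<^sub>R (\<Sum>r = 1..n. X r \<omega>)
            \<and> (\<forall>i j. i \<le> j \<longrightarrow>
                 K $ i $ j = (1 / real n) * (\<Sum>r = 1..n. X r \<omega> $ i * X r \<omega> $ j) - \<mu> $ i * \<mu> $ j))"
proof
  fix \<omega> assume "\<omega> \<in> space M"
  let ?x = "\<lambda>r. X r \<omega>"
  have "student \<alpha> \<nu> \<theta>" if "pos_def (snd \<theta>)" for \<theta> :: "'d student_param"
    using nu that by unfold_locales
  note eqs = basu_equation_iff[OF this n, where x = ?x] jones_equation_iff[OF this n, where x = ?x]
  \<comment> \<open>Both equations amount to the same moment conditions on every positive definite
    \<Sigma>, so the two solution sets coincide even when they are empty.\<close>
  have "pos_def \<Sigma> \<and> basu_equation \<alpha> \<nu> n ?x (\<mu>, \<Sigma>) \<longleftrightarrow> pos_def \<Sigma> \<and> jones_equation \<alpha> \<nu> n ?x (\<mu>, \<Sigma>)" for \<mu> \<Sigma>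
    using eqs[of "(\<mu>, \<Sigma>)"] by auto
  then have "basu_estimates \<alpha> \<nu> n ?x = jones_estimates \<alpha> \<nu> n ?x"
    by (simp only: basu_estimates_def jones_estimates_def)
  then show "basu_estimates \<alpha> \<nu> n ?x = jones_estimates \<alpha> \<nu> n ?x
         \<and> (\<forall>\<mu> K. (\<mu>, K) \<in> basu_estimates \<alpha> \<nu> n ?x \<longleftrightarrow>
              pos_def K
            \<and> \<mu> = (1 / real n) *\<^sub>R (\<Sum>r = 1..n. X r \<omega>)
            \<and> (\<forall>i j. i \<le> j \<longrightarrow>
                 K $ i $ j = (1 / real n) * (\<Sum>r = 1..n. X r \<omega> $ i * X r \<omega> $ j) - \<mu> $ i * \<mu> $ j))"
    using estimates_iff[OF nu n eqs(1)] by (simp only: basu_estimates_def) blast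
qed

end
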